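(* Let $(X_n)_{n\in\mathbb{Z}}$ be an INAR($\infty$) sequence with respect to immigration parameter $\alpha_0\ge0$ and reproduction coefficients $\alpha_k\ge0$, $k\in\mathbb{N}$, such that $K=\sum_{k=1}^\infty\alpha_k<1$. Then there exists a constant $\delta>0$ such that $$M_{(X_n)}\big((t_n)\big)\le\exp\Big\{d\,\alpha_0\,\frac{1+K}{2K}\Big\}<\infty,\qquad (t_n)\in c_{00}\big((-\infty,\delta]\big),$$ where $d:=\mathrm{supp}((t_n))+1$ is the maximal number of nonzero values of $(t_n)$. Furthermore, $$M_{(X_n)}\big((t_n)\big)=\exp\Big\{\alpha_0\sum_{i\in\mathbb{Z}}\Big(M_{(F_n)}\big((t_{i+n})_{n\in\mathbb{N}_0}\big)-1\Big)\Big\},$$ where $t_m:=0$ for $m<0$. Here $(F_n)$ denotes the generic family process of the INAR($\infty$) sequence. Its joint moment-generating function $M_{(F_n)}$ is the unique solution to $$M_{(F_n)}\big((s_n)\big)=e^{s_0}\exp\Big\{\sum_{k=1}^\infty\alpha_k\Big(M_{(F_n)}\big((s_{n+k})_{n\in\mathbb{N}_0}\big)-1\Big)\Big\},\qquad(s_n)\in c_{00}\big((-\infty,\delta]\big).$$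
   Context: INAR($\infty$): Given $\alpha_k\ge0$ ($k\in\mathbb{N}_0$) with $K=\sum_{k\ge1}\alpha_k<1$, let $\varepsilon_n$, $n\in\mathbb{Z}$, be i.i.d. $\mathrm{Pois}(\alpha_0)$ and $\xi^{(n,k)}_l\sim\mathrm{Pois}(\alpha_k)$ independently over $n\in\mathbb{Z}$, $k,l\in\mathbb{N}$ and independent of $(\varepsilon_n)$. The INAR($\infty$) sequence with immigration parameter $\alpha_0$ and reproduction coefficients $\alpha_k$, $k\in\mathbb{N}$, is the almost surely unique (strictly) stationary $\mathbb{N}_0$-valued solution $(X_n)_{n\in\mathbb{Z}}$ of $X_n=\varepsilon_n+\sum_{k=1}^\infty\sum_{l=1}^{X_{n-k}}\xi^{(n,k)}_l$, $n\in\mathbb{Z}$, where $\varepsilon_n$ and $(\xi^{(n,k)}_l)_{k,l}$ are independent of $X_{n-1},X_{n-2},\dots$. Generic family process: $F_n:=\sum_{g=0}^\infty G^{(g)}_n$, $n\in\mathbb{Z}$, with $G^{(0)}_n:=1_{\{n=0\}}$ and $G^{(g)}_n:=\sum_{k=1}^n\sum_{m=1}^{G^{(g-1)}_{n-k}}\xi^{(n,k,g)}_m$ for $g\in\mathbb{N}$, where $\xi^{(n,k,g)}_m\sim\mathrm{Pois}(\alpha_k)$ independently over $m,n,k,g$ (empty sums are zero). Notation: for a real sequence $(t_n)_{n\in\mathbb{N}_0}$, $\mathrm{supp}((t_n)):=\min\{n\in\mathbb{N}_0:\ t_k=0\text{ for all }k>n\}$, with $\min\emptyset:=\infty$. For $A\subset\mathbb{R}$,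 $c_{00}(A):=\{(t_n)_{n\in\mathbb{N}_0}\subset A:\ \mathrm{supp}((t_n))<\infty\}$. For a time series $(Y_n)$, the joint moment-generating function is $M_{(Y_n)}((t_n)_{n\in\mathbb{N}_0}):=\mathbb{E}\exp\{\sum_{n=0}^\infty t_nY_n\}$, $(t_n)\in c_{00}(\mathbb{R})$.
   Formalization: The solution M_F is unique among functions with value 1 at the zero sequence (for 0<K<1 the equation has a second solution, from the other root of x=exp(K(x-1))); the explicit bound is stated for K>0, since (1+K)/(2K) is undefined at K=0, where finiteness is still asserted. *)

theory Defs
  imports "HOL-Probability.Probability" "HOL-Library.Extended_Nat"
begin

text \<open>The library's \<^const>\<open>poisson_pmf\<close> is only specified for positive rates, whereas
  \<open>Pois(0)\<close>, the point mass at \<open>0\<close>, is needed here.\<close>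

definition pois :: "real \<Rightarrow> nat pmf" where
  "pois r = (if r = 0 then return_pmf 0 else poisson_pmf r)"

text \<open>The library's \<^const>\<open>prob_space.indep_var\<close> forces both random variables to have the same
  type; this is its version for random variables of different types.\<close>

definition (in prob_space) indep_rv ::
  "'b measure \<Rightarrow> ('a \<Rightarrow> 'b) \<Rightarrow> 'c measure \<Rightarrow> ('a \<Rightarrow> 'c) \<Rightarrow> bool" where
  "indep_rv S A T B \<longleftrightarrow> random_variable S A \<and> random_variable T B \<and>
     indep_set {A -` E \<inter> space M |E. E \<in> sets S} {B -` E \<inter> space M |E. E \<in> sets T}"

definition strictly_stationary :: "'a measure \<Rightarrow> (int \<Rightarrow> 'a \<Rightarrow> nat) \<Rightarrow> bool" where
  "strictly_stationary M X \<longleftrightarrow>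
     (\<forall>h. distr M (\<Pi>\<^sub>M n\<in>UNIV. count_space UNIV) (\<lambda>\<omega> n. X (n + h) \<omega>)
        = distr M (\<Pi>\<^sub>M n\<in>UNIV. count_space UNIV) (\<lambda>\<omega> n. X n \<omega>))"


section \<open>INAR(\<open>\<infinity>\<close>) sequences\<close>

text \<open>\<open>\<xi> n k l\<close> stands for \<open>\<xi>\<close> with upper index \<open>(n,k)\<close> and lower index \<open>l\<close>; only
  the values at \<open>k \<ge> 1\<close> and \<open>l \<ge> 1\<close> are relevant.\<close>

locale inar_noise = prob_space M for M :: "'a measure" +
  fixes \<alpha> :: "nat \<Rightarrow> real"
    and \<epsilon> :: "int \<Rightarrow> 'a \<Rightarrow> nat"
    and \<xi> :: "int \<Rightarrow> nat \<Rightarrow> nat \<Rightarrow> 'a \<Rightarrow> nat"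
  assumes indep_noise:
    "indep_vars (\<lambda>_. count_space UNIV)
       (\<lambda>i. case i of Inl n \<Rightarrow> \<epsilon> n | Inr (n, k, l) \<Rightarrow> \<xi> n k l)
       (UNIV <+> (UNIV \<times> {1..} \<times> {1..}))"
    and distr_\<epsilon>: "distr M (count_space UNIV) (\<epsilon> n) = measure_pmf (pois (\<alpha> 0))"
    and distr_\<xi>: "k \<ge> 1 \<Longrightarrow> l \<ge> 1 \<Longrightarrow>
      distr M (count_space UNIV) (\<xi> n k l) = measure_pmf (pois (\<alpha> k))"
begin

text \<open>The recursion is stated in \<^typ>\<open>ennreal\<close>, where the series over \<open>k\<close> always has a
  value; the equation thus includes the almost sure convergence of the series.\<close>

definition inar_solution :: "(int \<Rightarrow> 'a \<Rightarrow> nat) \<Rightarrow> bool" where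
  "inar_solution X \<longleftrightarrow>
     (\<forall>n. random_variable (count_space UNIV) (X n)) \<and>
     strictly_stationary M X \<and>
     (AE \<omega> in M. \<forall>n. of_nat (X n \<omega>) =
        (of_nat (\<epsilon> n \<omega>) +
         (\<Sum>k. of_nat (\<Sum>l = 1..X (n - int (Suc k)) \<omega>. \<xi> n (Suc k) l \<omega>)) :: ennreal)) \<and>
     (\<forall>n. indep_rv
        (count_space UNIV \<Otimes>\<^sub>M (\<Pi>\<^sub>M p\<in>{1..} \<times> {1..}. count_space UNIV))
        (\<lambda>\<omega>. (\<epsilon> n \<omega>, \<lambda>p\<in>{1..} \<times> {1..}. \<xi> n (fst p) (snd p) \<omega>))
        (\<Pi>\<^sub>M j\<in>{..<n}. count_space UNIV)
        (\<lambda>\<omega>. \<lambda>j\<in>{..<n}. X j \<omega>))"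

end

text \<open>The INAR(\<open>\<infinity>\<close>) sequence is \<^emph>\<open>the\<close> almost surely unique stationary solution; the second
  assumption is the uniqueness part of this definite description.\<close>

locale inar = inar_noise +
  fixes X :: "int \<Rightarrow> 'a \<Rightarrow> nat"
  assumes solution: "inar_solution X"
    and unique_solution: "inar_solution Y \<Longrightarrow> AE \<omega> in M. \<forall>n. Y n \<omega> = X n \<omega>"


section \<open>The generic family process\<close>

text \<open>\<open>\<zeta> n k g m\<close> stands for \<open>\<xi>\<close> with upper index \<open>(n,k,g)\<close> and lower index \<open>m\<close>.\<close>

locale family_noise = prob_space N for N :: "'b measure" +
  fixes \<alpha> :: "nat \<Rightarrow> real"
    and \<zeta> :: "int \<Rightarrow> nat \<Rightarrow> nat \<Rightarrow> nat \<Rightarrow> 'b \<Rightarrow> nat"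
  assumes indep_\<zeta>:
    "indep_vars (\<lambda>_. count_space UNIV) (\<lambda>(n, k, g, m). \<zeta> n k g m)
       (UNIV \<times> {1..} \<times> {1..} \<times> {1..})"
    and distr_\<zeta>: "k \<ge> 1 \<Longrightarrow> g \<ge> 1 \<Longrightarrow> m \<ge> 1 \<Longrightarrow>
      distr N (count_space UNIV) (\<zeta> n k g m) = measure_pmf (pois (\<alpha> k))"

primrec generation ::
  "(int \<Rightarrow> nat \<Rightarrow> nat \<Rightarrow> nat \<Rightarrow> 'b \<Rightarrow> nat) \<Rightarrow> nat \<Rightarrow> int \<Rightarrow> 'b \<Rightarrow> nat" where
  "generation \<zeta> 0 n \<omega> = (if n = 0 then 1 else 0)"
| "generation \<zeta> (Suc g) n \<omega> =
     (\<Sum>k = 1..nat n. \<Sum>m = 1..generation \<zeta> g (n - int k) \<omega>. \<zeta> n k (Suc g) m \<omega>)"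

text \<open>The series is a finite sum, since \<open>generation \<zeta> g n \<omega> = 0\<close> if \<open>int g > max 0 n\<close>.\<close>

definition family :: "(int \<Rightarrow> nat \<Rightarrow> nat \<Rightarrow> nat \<Rightarrow> 'b \<Rightarrow> nat) \<Rightarrow> int \<Rightarrow> 'b \<Rightarrow> nat" where
  "family \<zeta> n \<omega> = (\<Sum>g. generation \<zeta> g n \<omega>)"


section \<open>Joint moment-generating functions\<close>

definition seq_supp :: "(nat \<Rightarrow> real) \<Rightarrow> enat" where
  "seq_supp t = (INF n\<in>{n. \<forall>k>n. t k = 0}. enat n)"

definition c00 :: "real set \<Rightarrow> (nat \<Rightarrow> real) set" where
  "c00 A = {t. range t \<subseteq> A \<and> seq_supp t < \<infinity>}"

text \<open>With values in \<open>[0,\<infinity>]\<close>, so that finiteness is a meaningful statement.\<close>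

definition joint_mgf :: "'a measure \<Rightarrow> (int \<Rightarrow> 'a \<Rightarrow> nat) \<Rightarrow> (nat \<Rightarrow> real) \<Rightarrow> ennreal" where
  "joint_mgf M Y t = (\<integral>\<^sup>+\<omega>. ennreal (exp (\<Sum>n. t n * real (Y (int n) \<omega>))) \<partial>M)"

text \<open>The sequence of all \<open>t\<^bsub>i+n\<^esub>\<close>, \<open>n \<ge> 0\<close>, where \<open>t\<^sub>m = 0\<close> for \<open>m < 0\<close>.\<close>

definition shift_seq :: "int \<Rightarrow> (nat \<Rightarrow> real) \<Rightarrow> nat \<Rightarrow> real" where
  "shift_seq i t n = (if i + int n < 0 then 0 else t (nat (i + int n)))"

text \<open>The implicit equation for the moment-generating function of the family process.\<close>

definition solves_family_equation ::
  "(nat \<Rightarrow> real) \<Rightarrow> real \<Rightarrow> ((nat \<Rightarrow> real) \<Rightarrow> real) \<Rightarrow> bool" where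
  "solves_family_equation \<alpha> \<delta> \<phi> \<longleftrightarrow>
     (\<forall>s\<in>c00 {..\<delta>}.
        summable (\<lambda>k. \<alpha> (Suc k) * (\<phi> (\<lambda>n. s (n + Suc k)) - 1)) \<and>
        \<phi> s = exp (s 0) * exp (\<Sum>k. \<alpha> (Suc k) * (\<phi> (\<lambda>n. s (n + Suc k)) - 1)))"

end

theory Submission
  imports Defs
begin

text \<open>
  Start the recursion from the empty past at time \<open>- L\<close>. Given the past, the value at the last
  time is a sum of independent Poisson variables, so integrating it out turns its exponent \<open>c\<close> into
  the weight \<open>exp c - 1\<close> of the immigration and, multiplied by the reproduction coefficients, into
  additional exponents of the earlier values. Going back in time, the exponents solve the logarithm
  of the functional equation of the family process, whose generations can be integrated out in the
  same way. Hence the truncated process has moment-generating function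
  \<open>exp (\<alpha>\<^sub>0 \<Sum>\<^sub>i (M\<^sub>F(t\<^bsub>i+\<cdot>\<^esub>) - 1))\<close>, the sum being over \<open>i \<ge> - L\<close>. For \<open>t \<le> \<delta>\<close> the terms of this sum
  satisfy a subcritical renewal inequality, which bounds the sums uniformly in \<open>L\<close>. So the
  truncations, which increase with \<open>L\<close>, have an almost surely finite limit. This limit is a
  stationary solution, by uniqueness it is the INAR sequence, and its moment-generating function is
  obtained by dominated convergence.
\<close>

section \<open>Integrating out independent Poisson variables\<close>

text \<open>Conditioning on the past of the stationary sequence would never end, since it reaches
  back to all earlier times. A truncation involves finitely many times, so the elimination is a
  finite induction, and the exponents come from a recursion that stops at the end of the support.
  The exact formulas for truncations and for the family process therefore hold for all real
  exponents; the radius enters only when the starting time recedes to minus infinity. There one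
  needs a bound \<open>b\<close> on the weights that reproduces itself: if all later weights are at
  most \<open>b\<close>, the next exponent is at most \<open>\<delta> + K * b\<close>, and
  \<open>exp (\<delta> + K * b) \<le> 1 + b\<close> closes the circle. Two sums of weights are
  estimated. Positive parts bound the integrals, with constants chosen to give at most 1 per nonzero
  exponent. Absolute values give summability over the integers, and have to cope with exponents that
  are not bounded below. With exponents of both signs the integrands are not monotone in the depth
  of the truncation, so the passage to the limit is dominated by the expression with exponents
  \<open>max 0 (t n)\<close>.\<close>

lemma nn_integral_exp_pois:
  assumes "r \<ge> 0"
  shows "(\<integral>\<^sup>+x. ennreal (exp (c * real x)) \<partial>measure_pmf (pois r)) = ennreal (exp (r * (exp c - 1)))"
proof (cases "r = 0")
  case True
  then show ?thesis by (simp add: pois_def nn_integral_return_pmf)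
next
  case False
  with assms have r: "r > 0" by simp
  have eq: "ennreal (pmf (poisson_pmf r) k) * ennreal (exp (c * real k))
      = ennreal (exp (- r) * ((r * exp c) ^ k /\<^sub>R fact k))" for k
  proof -
    have "exp (c * real k) = exp c ^ k"
      by (rule exp_of_nat2_mult)
    then have "pmf (poisson_pmf r) k * exp (c * real k) = exp (- r) * ((r * exp c) ^ k /\<^sub>R fact k)"
      unfolding pmf_poisson[OF r] by (simp only: power_mult_distrib divide_inverse mult_ac real_scaleR_def)
    then show ?thesis
      by (subst ennreal_mult[symmetric]) (simp_all only: pmf_nonneg exp_ge_zero)
  qed
  have "(\<integral>\<^sup>+x. ennreal (exp (c * real x)) \<partial>measure_pmf (pois r))
      = (\<Sum>k. ennreal (exp (- r) * ((r * exp c) ^ k /\<^sub>R fact k)))"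
    unfolding pois_def if_not_P[OF False] nn_integral_measure_pmf nn_integral_count_space_nat eq ..
  also have "\<dots> = ennreal (exp (- r) * exp (r * exp c))"
  proof (rule suminf_ennreal_eq)
    show "(\<lambda>k. exp (- r) * ((r * exp c) ^ k /\<^sub>R fact k)) sums (exp (- r) * exp (r * exp c))"
      by (intro sums_mult exp_converges)
    show "0 \<le> exp (- r) * ((r * exp c) ^ k /\<^sub>R fact k)" for k
      using r by (intro mult_nonneg_nonneg scaleR_nonneg_nonneg zero_le_power) auto
  qed
  also have "exp (- r) * exp (r * exp c) = exp (r * (exp c - 1))"
    unfolding exp_add[symmetric] by (rule arg_cong[of _ _ exp]) algebra
  finally show ?thesis .
qed

text \<open>The \<sigma>-algebra of the noise variables with index in \<open>A\<close>.
  Measurability with respect to it expresses that something is a function of this block of noise, so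
  independence of disjoint blocks passes to whatever is built from them.\<close>

definition gen_sigma :: "'a measure \<Rightarrow> ('i \<Rightarrow> 'a \<Rightarrow> nat) \<Rightarrow> 'i set \<Rightarrow> 'a measure" where
  "gen_sigma M Z A = sigma (space M) (\<Union>i\<in>A. {Z i -` E \<inter> space M |E. True})"

lemma space_gen_sigma [simp]: "space (gen_sigma M Z A) = space M"
  unfolding gen_sigma_def by (rule space_measure_of) auto

lemma sets_gen_sigma:
  "sets (gen_sigma M Z A) = sigma_sets (space M) (\<Union>i\<in>A. {Z i -` E \<inter> space M |E. True})"
  unfolding gen_sigma_def by (rule sets_measure_of) auto

lemma measurable_gen_sigma:
  assumes "i \<in> A"
  shows "Z i \<in> gen_sigma M Z A \<rightarrow>\<^sub>M count_space UNIV"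
proof (rule measurableI)
  show "Z i -` E \<inter> space (gen_sigma M Z A) \<in> sets (gen_sigma M Z A)" for E
    unfolding sets_gen_sigma space_gen_sigma by (rule sigma_sets.Basic) (use assms in blast)
qed simp

lemma gen_sigma_subset:
  assumes "\<And>i. i \<in> A \<Longrightarrow> Z i \<in> M \<rightarrow>\<^sub>M count_space UNIV"
  shows "sets (gen_sigma M Z A) \<subseteq> sets M"
  unfolding sets_gen_sigma
proof (rule sets.sigma_sets_subset, safe)
  fix i E assume "i \<in> A"
  from measurable_sets[OF assms[OF this], of E] show "Z i -` E \<inter> space M \<in> sets M" by simp
qed

lemma measurable_gen_sigmaD:
  assumes rv: "\<And>i. i \<in> A \<Longrightarrow> Z i \<in> M \<rightarrow>\<^sub>M count_space UNIV"
    and f: "f \<in> gen_sigma M Z A \<rightarrow>\<^sub>M N"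
  shows "f \<in> M \<rightarrow>\<^sub>M N"
proof (rule measurableI)
  show "f x \<in> space N" if "x \<in> space M" for x
    using measurable_space[OF f] that by simp
  show "f -` E \<inter> space M \<in> sets M" if "E \<in> sets N" for E
    using measurable_sets[OF f that] gen_sigma_subset[of A Z M, OF rv] by auto
qed

section \<open>Measurability of sums and lists of natural-number-valued variables\<close>

lemma measurable_nat_add:
  fixes f g :: "'a \<Rightarrow> nat"
  assumes f: "f \<in> M \<rightarrow>\<^sub>M count_space UNIV" and g: "g \<in> M \<rightarrow>\<^sub>M count_space UNIV"
  shows "(\<lambda>x. f x + g x) \<in> M \<rightarrow>\<^sub>M count_space UNIV"
proof -
  have "(\<lambda>x. a + g x) \<in> M \<rightarrow>\<^sub>M count_space UNIV" for a
    by (rule measurable_compose[OF g, of "(+) a"]) simp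
  from measurable_compose_countable[where f="\<lambda>a x. a + g x", OF this f] show ?thesis .
qed

lemma measurable_nat_sum:
  fixes f :: "'i \<Rightarrow> 'a \<Rightarrow> nat"
  assumes "\<And>i. i \<in> I \<Longrightarrow> f i \<in> M \<rightarrow>\<^sub>M count_space UNIV"
  shows "(\<lambda>x. \<Sum>i\<in>I. f i x) \<in> M \<rightarrow>\<^sub>M count_space UNIV"
  using assms
proof (induction I rule: infinite_finite_induct)
  case (insert i I)
  then show ?case by (simp add: measurable_nat_add)
qed simp_all

text \<open>The random upper limit takes countably many values, and on each of them the range of
  summation is fixed.\<close>

lemma measurable_nat_random_sum:
  fixes f :: "nat \<Rightarrow> 'a \<Rightarrow> nat"
  assumes f: "\<And>l. l \<ge> 1 \<Longrightarrow> f l \<in> M \<rightarrow>\<^sub>M count_space UNIV" and h: "h \<in> M \<rightarrow>\<^sub>M count_space UNIV"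
  shows "(\<lambda>x. \<Sum>l=1..h x. f l x) \<in> M \<rightarrow>\<^sub>M count_space UNIV"
proof -
  have "(\<lambda>x. \<Sum>l=1..n. f l x) \<in> M \<rightarrow>\<^sub>M count_space UNIV" for n
    by (rule measurable_nat_sum) (simp add: f)
  from measurable_compose_countable[where f="\<lambda>n x. \<Sum>l=1..n. f l x", OF this h] show ?thesis .
qed

text \<open>Packs finitely many past values into one variable of a countable type, over whose values
  an integral can be split.\<close>

lemma measurable_map_list:
  fixes f :: "'i \<Rightarrow> 'a \<Rightarrow> nat"
  assumes "\<And>i. i \<in> set xs \<Longrightarrow> f i \<in> M \<rightarrow>\<^sub>M count_space UNIV"
  shows "(\<lambda>x. map (\<lambda>i. f i x) xs) \<in> M \<rightarrow>\<^sub>M count_space UNIV"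
  using assms
proof (induction xs)
  case (Cons i xs)
  have IH: "(\<lambda>x. map (\<lambda>i. f i x) xs) \<in> M \<rightarrow>\<^sub>M count_space UNIV"
    by (rule Cons.IH) (simp add: Cons.prems)
  have "(\<lambda>x. a # map (\<lambda>i. f i x) xs) \<in> M \<rightarrow>\<^sub>M count_space UNIV" for a
    by (rule measurable_compose[OF IH, of "(#) a"]) simp
  from measurable_compose_countable[where f="\<lambda>a x. a # map (\<lambda>i. f i x) xs" and g="f i", OF this]
  show ?case
    by (simp add: Cons.prems)
qed simp

context prob_space
begin

text \<open>The two blocks form a family indexed by \<open>bool\<close>, to which the grouping
  theorem for independent, intersection-stable generators applies.\<close>

lemma indep_set_gen_sigma:
  assumes Z: "indep_vars (\<lambda>_. count_space UNIV) Z I"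
    and "A \<subseteq> I" "B \<subseteq> I" "A \<inter> B = {}"
  shows "indep_set (sets (gen_sigma M Z A)) (sets (gen_sigma M Z B))"
proof -
  let ?K = "case_bool A B"
  have "indep_sets (\<lambda>j. sigma_sets (space M) (\<Union>i\<in>?K j. {Z i -` E \<inter> space M |E. True})) UNIV"
  proof (rule indep_sets_collect_sigma)
    have "(\<Union>j. ?K j) \<subseteq> I" using assms(2,3) by (auto split: bool.splits)
    moreover have "indep_sets (\<lambda>i. {Z i -` E \<inter> space M |E. True}) I"
      using Z unfolding indep_vars_def2 by simp
    ultimately show "indep_sets (\<lambda>i. {Z i -` E \<inter> space M |E. True}) (\<Union>j. ?K j)"
      by (rule indep_sets_mono_index)
    show "Int_stable {Z i -` E \<inter> space M |E. True}" for i
    proof (rule Int_stableI)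
      fix a b assume "a \<in> {Z i -` E \<inter> space M |E. True}" "b \<in> {Z i -` E \<inter> space M |E. True}"
      then obtain E F where "a = Z i -` E \<inter> space M" "b = Z i -` F \<inter> space M" by blast
      then have "a \<inter> b = Z i -` (E \<inter> F) \<inter> space M" by auto
      then show "a \<inter> b \<in> {Z i -` E \<inter> space M |E. True}" by blast
    qed
    show "disjoint_family ?K"
      using assms(4) by (auto simp: disjoint_family_on_def split: bool.splits)
  qed
  moreover have "(\<lambda>j. sigma_sets (space M) (\<Union>i\<in>?K j. {Z i -` E \<inter> space M |E. True}))
      = case_bool (sets (gen_sigma M Z A)) (sets (gen_sigma M Z B))"
    by (rule ext) (simp add: sets_gen_sigma split: bool.split)
  ultimately show ?thesis
    unfolding indep_set_def by simp
qed

lemma nn_integral_mult_gen_sigma: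
  assumes Z: "indep_vars (\<lambda>_. count_space UNIV) Z I"
    and AB: "A \<subseteq> I" "B \<subseteq> I" "A \<inter> B = {}"
    and g: "g \<in> borel_measurable (gen_sigma M Z A)"
    and h: "h \<in> borel_measurable (gen_sigma M Z B)"
  shows "(\<integral>\<^sup>+x. g x * h x \<partial>M) = (\<integral>\<^sup>+x. g x \<partial>M) * (\<integral>\<^sup>+x. (h x :: ennreal) \<partial>M)"
proof -
  have rv: "Z i \<in> M \<rightarrow>\<^sub>M count_space UNIV" if "i \<in> I" for i
    using Z that by (auto simp: indep_vars_def)
  have gM: "g \<in> borel_measurable M" and hM: "h \<in> borel_measurable M"
    by (rule measurable_gen_sigmaD[OF _ g] measurable_gen_sigmaD[OF _ h]; use rv AB in blast)+
  have "indep_var borel g borel h"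
    unfolding indep_var_eq
  proof (intro conjI gM hM)
    have "sigma_sets (space M) {f -` E \<inter> space M |E. E \<in> sets borel} \<subseteq> sets (gen_sigma M Z C)"
      if f: "f \<in> borel_measurable (gen_sigma M Z C)" for C and f :: "'a \<Rightarrow> ennreal"
    proof (rule sets.sigma_sets_subset[of _ "gen_sigma M Z C", simplified])
      show "{f -` E \<inter> space M |E. E \<in> sets borel} \<subseteq> sets (gen_sigma M Z C)"
        using measurable_sets[OF f] by (simp add: subset_eq) blast
    qed
    from this[OF g] this[OF h]
    show "indep_set (sigma_sets (space M) {g -` E \<inter> space M |E. E \<in> sets borel})
        (sigma_sets (space M) {h -` E \<inter> space M |E. E \<in> sets borel})"
      using indep_set_gen_sigma[OF Z AB] unfolding indep_sets2_eq by blast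
  qed
  moreover have "case_bool borel borel = (\<lambda>_. borel :: ennreal measure)"
    by (rule ext) (simp split: bool.split)
  ultimately have "indep_vars (\<lambda>_. borel) (case_bool g h) UNIV"
    unfolding indep_var_def by simp
  from indep_vars_nn_integral[OF _ this] show ?thesis
    by (simp add: UNIV_bool mult.commute)
qed

lemma nn_integral_split_countable:
  fixes H :: "'a \<Rightarrow> 'h::countable" and f :: "'a \<Rightarrow> ennreal"
  assumes [measurable]: "H \<in> M \<rightarrow>\<^sub>M count_space UNIV" "f \<in> borel_measurable M"
  shows "(\<integral>\<^sup>+x. f x \<partial>M) = (\<Sum>n. \<integral>\<^sup>+x. f x * indicator {x. to_nat (H x) = n} x \<partial>M)"
proof -
  have "(\<integral>\<^sup>+x. f x \<partial>M) = (\<integral>\<^sup>+x. (\<Sum>n. f x * indicator {x. to_nat (H x) = n} x) \<partial>M)"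
  proof (rule nn_integral_cong)
    fix x
    have "(\<Sum>n. f x * indicator {x. to_nat (H x) = n} x)
        = (\<Sum>n\<in>{to_nat (H x)}. f x * indicator {x. to_nat (H x) = n} x)"
      by (rule suminf_finite) auto
    then show "f x = (\<Sum>n. f x * indicator {x. to_nat (H x) = n} x)" by simp
  qed
  also have "\<dots> = (\<Sum>n. \<integral>\<^sup>+x. f x * indicator {x. to_nat (H x) = n} x \<partial>M)"
    by (rule nn_integral_suminf) measurable
  finally show ?thesis .
qed

text \<open>The set of variables to be integrated out is random, because it depends on the number of
  parents, but \<open>H\<close> is a function of the noise in \<open>A\<close>. Where
  \<open>H\<close> has a fixed value the set is fixed too, and independence of the blocks lets the
  product of Poisson transforms factor out. \<open>g\<close> carries everything else that depends on
  the past.\<close>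

lemma nn_integral_poisson_step:
  fixes Z :: "'i \<Rightarrow> 'a \<Rightarrow> nat" and H :: "'a \<Rightarrow> 'h::countable" and g :: "'a \<Rightarrow> ennreal"
  assumes Z: "indep_vars (\<lambda>_. count_space UNIV) Z I"
    and AB: "A \<subseteq> I" "B \<subseteq> I" "A \<inter> B = {}"
    and r: "\<And>i. i \<in> B \<Longrightarrow> r i \<ge> 0"
    and dZ: "\<And>i. i \<in> B \<Longrightarrow> distr M (count_space UNIV) (Z i) = measure_pmf (pois (r i))"
    and H: "H \<in> gen_sigma M Z A \<rightarrow>\<^sub>M count_space UNIV"
    and g: "g \<in> borel_measurable (gen_sigma M Z A)"
    and J: "\<And>h. finite (J h)" "\<And>h. J h \<subseteq> B"
  shows "(\<integral>\<^sup>+x. g x * ennreal (exp (\<Sum>i\<in>J (H x). c i * real (Z i x))) \<partial>M)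
       = (\<integral>\<^sup>+x. g x * ennreal (exp (\<Sum>i\<in>J (H x). r i * (exp (c i) - 1))) \<partial>M)"
proof -
  have rv: "Z i \<in> M \<rightarrow>\<^sub>M count_space UNIV" if "i \<in> I" for i
    using Z that by (auto simp: indep_vars_def)
  note [measurable] = H g
  have HM[measurable]: "H \<in> M \<rightarrow>\<^sub>M count_space UNIV" and gM[measurable]: "g \<in> borel_measurable M"
    by (rule measurable_gen_sigmaD[OF _ H] measurable_gen_sigmaD[OF _ g]; use rv AB in blast)+
  have meas: "(\<lambda>x. exp (\<Sum>i\<in>J h. c i * real (Z i x))) \<in> borel_measurable (gen_sigma M Z B)" for h
  proof -
    have "(\<lambda>x. real (Z i x)) \<in> borel_measurable (gen_sigma M Z B)" if "i \<in> J h" for i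
      by (rule measurable_compose[OF measurable_gen_sigma]) (use J that in auto)
    then show ?thesis by measurable
  qed
  have measM: "(\<lambda>x. exp (\<Sum>i\<in>J h. c i * real (Z i x))) \<in> borel_measurable M" for h
    by (rule measurable_gen_sigmaD[OF _ meas]) (use AB rv in auto)
  have prod: "(\<integral>\<^sup>+x. ennreal (exp (\<Sum>i\<in>J h. c i * real (Z i x))) \<partial>M)
      = ennreal (exp (\<Sum>i\<in>J h. r i * (exp (c i) - 1)))" for h
  proof -
    have sub: "J h \<subseteq> I" using AB J by blast
    have "(\<integral>\<^sup>+x. ennreal (exp (\<Sum>i\<in>J h. c i * real (Z i x))) \<partial>M)
        = (\<integral>\<^sup>+x. (\<Prod>i\<in>J h. ennreal (exp (c i * real (Z i x)))) \<partial>M)"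
      using J by (simp add: exp_sum prod_ennreal)
    also have "\<dots> = (\<Prod>i\<in>J h. \<integral>\<^sup>+x. ennreal (exp (c i * real (Z i x))) \<partial>M)"
      using indep_vars_compose2[OF indep_vars_subset[OF Z sub], of "\<lambda>i n. ennreal (exp (c i * real n))" "\<lambda>_. borel"] J
      by (intro indep_vars_nn_integral) auto
    also have "\<dots> = (\<Prod>i\<in>J h. ennreal (exp (r i * (exp (c i) - 1))))"
    proof (rule prod.cong)
      fix i assume "i \<in> J h"
      then have i: "i \<in> B" "i \<in> I" using J sub by auto
      have "(\<integral>\<^sup>+x. ennreal (exp (c i * real (Z i x))) \<partial>M)
          = (\<integral>\<^sup>+n. ennreal (exp (c i * real n)) \<partial>distr M (count_space UNIV) (Z i))"
        by (subst nn_integral_distr) (use rv i in auto)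
      also have "\<dots> = ennreal (exp (r i * (exp (c i) - 1)))"
        unfolding dZ[OF i(1)] by (rule nn_integral_exp_pois) (use r i in auto)
      finally show "(\<integral>\<^sup>+x. ennreal (exp (c i * real (Z i x))) \<partial>M) = ennreal (exp (r i * (exp (c i) - 1)))" .
    qed simp
    also have "\<dots> = ennreal (exp (\<Sum>i\<in>J h. r i * (exp (c i) - 1)))"
      using J by (simp add: exp_sum prod_ennreal)
    finally show ?thesis .
  qed
  have 1: "(\<lambda>x. (\<lambda>h x. ennreal (exp (\<Sum>i\<in>J h. c i * real (Z i x)))) (H x) x) \<in> borel_measurable M"
    by (rule measurable_compose_countable[OF _ HM]) (use measM in measurable)
  have 2: "(\<lambda>x. (\<lambda>h x. ennreal (exp (\<Sum>i\<in>J h. r i * (exp (c i) - 1)))) (H x) x) \<in> borel_measurable M"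
    by (rule measurable_compose_countable[OF _ HM]) simp
  have 3: "(\<integral>\<^sup>+x. g x * ennreal (exp (\<Sum>i\<in>J (H x). c i * real (Z i x))) * indicator {x. to_nat (H x) = n} x \<partial>M)
      = (\<integral>\<^sup>+x. g x * ennreal (exp (\<Sum>i\<in>J (H x). r i * (exp (c i) - 1))) * indicator {x. to_nat (H x) = n} x \<partial>M)" for n
  proof (cases "n \<in> range (to_nat :: 'h \<Rightarrow> nat)")
    case True
    then obtain h :: 'h where n: "n = to_nat h" by auto
    \<comment> \<open>The indicator depends on \<open>H\<close> only, so it can be absorbed in the
      factor that belongs to the past.\<close>
    define g' where "g' x = g x * indicator {x. to_nat (H x) = n} x" for x
    have g': "g' \<in> borel_measurable (gen_sigma M Z A)" unfolding g'_def by measurable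
    have "(\<integral>\<^sup>+x. g x * ennreal (exp (\<Sum>i\<in>J (H x). c i * real (Z i x))) * indicator {x. to_nat (H x) = n} x \<partial>M)
       = (\<integral>\<^sup>+x. g' x * ennreal (exp (\<Sum>i\<in>J h. c i * real (Z i x))) \<partial>M)"
      by (intro nn_integral_cong) (auto simp: g'_def n split: split_indicator)
    also have "\<dots> = (\<integral>\<^sup>+x. g' x \<partial>M) * (\<integral>\<^sup>+x. ennreal (exp (\<Sum>i\<in>J h. c i * real (Z i x))) \<partial>M)"
      using meas by (intro nn_integral_mult_gen_sigma[OF Z AB g']) auto
    also have "\<dots> = (\<integral>\<^sup>+x. g' x * ennreal (exp (\<Sum>i\<in>J h. r i * (exp (c i) - 1))) \<partial>M)"
      unfolding prod by (rule nn_integral_multc[symmetric])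
        (rule measurable_gen_sigmaD[OF _ g'], use AB rv in auto)
    also have "\<dots> = (\<integral>\<^sup>+x. g x * ennreal (exp (\<Sum>i\<in>J (H x). r i * (exp (c i) - 1))) * indicator {x. to_nat (H x) = n} x \<partial>M)"
      by (intro nn_integral_cong) (auto simp: g'_def n split: split_indicator)
    finally show ?thesis .
  next
    \<comment> \<open>A code outside the range of \<open>to_nat\<close> stands for no value, so its
      event is empty.\<close>
    case False
    then have "indicator {x. to_nat (H x) = n} x = (0::ennreal)" for x
      by (auto simp: indicator_def)
    then show ?thesis by simp
  qed
  show ?thesis
    by (subst (1 2) nn_integral_split_countable[OF HM]) (use 1 2 3 in simp_all)
qed

end

section \<open>Generations of the family process\<close>

text \<open>Pairs of a birth time \<open>j\<close> and a lag \<open>k\<close> are regrouped by the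
  parent's time \<open>j - k\<close>.\<close>

lemma sum_diff_swap:
  fixes f :: "nat \<Rightarrow> nat \<Rightarrow> 'c::comm_monoid_add"
  shows "(\<Sum>j\<le>m. \<Sum>k=1..j. f (j - k) k) = (\<Sum>i\<le>m. \<Sum>k=1..m-i. f i k)"
proof -
  have "(\<Sum>j\<le>m. \<Sum>k=1..j. f (j - k) k) = (\<Sum>(j,k)\<in>(SIGMA j:{..m}. {1..j}). f (j - k) k)"
    by (simp add: sum.Sigma)
  also have "\<dots> = (\<Sum>(i,k)\<in>(SIGMA i:{..m}. {1..m-i}). f i k)"
    by (rule sum.reindex_bij_witness[of _ "\<lambda>(i,k). (i + k, k)" "\<lambda>(j,k). (j - k, k)"]) auto
  also have "\<dots> = (\<Sum>i\<le>m. \<Sum>k=1..m-i. f i k)"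
    by (simp add: sum.Sigma)
  finally show ?thesis .
qed

text \<open>Children are born at least one time unit after their parent, so every generation costs
  one unit of time.\<close>

lemma generation_eq_0: "n < int g \<Longrightarrow> generation \<zeta> g n \<omega> = 0"
proof (induction g arbitrary: n)
  case (Suc g)
  have "generation \<zeta> g (n - int k) \<omega> = 0" if "k \<ge> 1" for k
    using Suc.prems that by (intro Suc.IH) simp
  then show ?case by simp
qed simp

lemma family_eq_sum: "n \<le> m \<Longrightarrow> family \<zeta> (int n) \<omega> = (\<Sum>g\<le>m. generation \<zeta> g (int n) \<omega>)"
  unfolding family_def by (rule suminf_finite) (auto intro: generation_eq_0)

lemma generation_measurable:
  assumes "\<And>n k h m. k \<ge> 1 \<Longrightarrow> 1 \<le> h \<Longrightarrow> h \<le> g \<Longrightarrow> m \<ge> 1 \<Longrightarrow> \<zeta> n k h m \<in> M' \<rightarrow>\<^sub>M count_space UNIV"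
  shows "generation \<zeta> g n \<in> M' \<rightarrow>\<^sub>M count_space UNIV"
  using assms
proof (induction g arbitrary: n)
  case 0
  have "generation \<zeta> 0 n = (\<lambda>_. if n = 0 then 1 else 0)" by (rule ext) simp
  then show ?case by simp
next
  case (Suc g)
  have IH: "generation \<zeta> g n' \<in> M' \<rightarrow>\<^sub>M count_space UNIV" for n'
    by (rule Suc.IH) (simp add: Suc.prems)
  have "(\<lambda>\<omega>. \<Sum>m=1..generation \<zeta> g (n - int k) \<omega>. \<zeta> n k (Suc g) m \<omega>) \<in> M' \<rightarrow>\<^sub>M count_space UNIV"
    if "k \<ge> 1" for k
    by (rule measurable_nat_random_sum) (use Suc.prems that IH in auto)
  then have "(\<lambda>\<omega>. \<Sum>k=1..nat n. \<Sum>m=1..generation \<zeta> g (n - int k) \<omega>. \<zeta> n k (Suc g) m \<omega>)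
      \<in> M' \<rightarrow>\<^sub>M count_space UNIV"
    by (intro measurable_nat_sum) auto
  moreover have "generation \<zeta> (Suc g) n
      = (\<lambda>\<omega>. \<Sum>k=1..nat n. \<Sum>m=1..generation \<zeta> g (n - int k) \<omega>. \<zeta> n k (Suc g) m \<omega>)"
    by (rule ext) simp
  ultimately show ?case by simp
qed

lemma borel_measurable_real_nat:
  "f \<in> M \<rightarrow>\<^sub>M count_space UNIV \<Longrightarrow> (\<lambda>x. real (f x)) \<in> borel_measurable M"
  by (rule measurable_compose[where g=real and N="count_space UNIV"]) simp_all

context family_noise
begin

abbreviation "family_index \<equiv> (UNIV \<times> {1..} \<times> {1..} \<times> {1..} :: (int \<times> nat \<times> nat \<times> nat) set)"
abbreviation "\<zeta>' \<equiv> (\<lambda>(n, k, g, m). \<zeta> n k g m)"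

text \<open>The exponents \<open>c j\<close> solve the logarithm of the functional equation. They turn the
  expression below into an invariant of \<open>g\<close>: integrating out generation \<open>g + 1\<close>
  adds to each exponent \<open>s j\<close> of generation \<open>g\<close> exactly the amount that makes it \<open>c j\<close>.\<close>

lemma nn_integral_generation:
  assumes \<alpha>: "\<And>k. \<alpha> k \<ge> 0"
    and c: "\<And>j. j \<le> m \<Longrightarrow> c j = s j + (\<Sum>k=1..m-j. \<alpha> k * (exp (c (j + k)) - 1))"
  shows "(\<integral>\<^sup>+\<omega>. ennreal (exp ((\<Sum>h<g. \<Sum>j\<le>m. s j * real (generation \<zeta> h (int j) \<omega>))
            + (\<Sum>j\<le>m. c j * real (generation \<zeta> g (int j) \<omega>)))) \<partial>N) = ennreal (exp (c 0))"
proof (induction g)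
  case 0
  have "(\<Sum>j\<le>m. c j * real (generation \<zeta> 0 (int j) \<omega>)) = c 0" for \<omega>
    by (simp add: if_distrib[of "\<lambda>x. c _ * real x"] sum.delta cong: if_cong)
  then show ?case
    by (simp add: emeasure_space_1)
next
  case (Suc g)
  define A where "A = {i \<in> family_index. fst (snd (snd i)) \<le> g}"
  define B where "B = {i \<in> family_index. fst (snd (snd i)) = Suc g}"
  define H where "H = (\<lambda>\<omega>. map (\<lambda>j. generation \<zeta> g (int j) \<omega>) [0..<Suc m])"
  \<comment> \<open>The variables that make up generation \<open>Suc g\<close> up to time
    \<open>m\<close>: birth time \<open>j\<close>, lag \<open>k\<close> to the parent, and the
    number \<open>l\<close> of the parent among those at time \<open>j - k\<close>.\<close>
  define T where "T = (\<lambda>h::nat list. SIGMA j:{..m}. SIGMA k:{1..j}. {1..h ! (j - k)})"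
  define emb :: "nat \<times> nat \<times> nat \<Rightarrow> int \<times> nat \<times> nat \<times> nat" where "emb = (\<lambda>(j,k,l). (int j, k, Suc g, l))"
  define P where "P = (\<lambda>\<omega>. ennreal (exp (\<Sum>h<Suc g. \<Sum>j\<le>m. s j * real (generation \<zeta> h (int j) \<omega>))))"
  have inj: "inj_on emb X" for X by (auto simp: inj_on_def emb_def)
  have gen: "generation \<zeta> h n \<in> gen_sigma N \<zeta>' A \<rightarrow>\<^sub>M count_space UNIV" if "h \<le> g" for h n
  proof (rule generation_measurable)
    fix n :: int and k h' m :: nat assume *: "k \<ge> 1" "1 \<le> h'" "h' \<le> h" "m \<ge> 1"
    have "\<zeta>' (n,k,h',m) \<in> gen_sigma N \<zeta>' A \<rightarrow>\<^sub>M count_space UNIV"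
      by (rule measurable_gen_sigma) (use * that in \<open>auto simp: A_def\<close>)
    then show "\<zeta> n k h' m \<in> gen_sigma N \<zeta>' A \<rightarrow>\<^sub>M count_space UNIV" by simp
  qed
  have Hnth: "H \<omega> ! j = generation \<zeta> g (int j) \<omega>" if "j \<le> m" for j \<omega>
    using that by (auto simp: H_def nth_append)
  have sumT: "(\<Sum>i\<in>emb ` T h. f i) = (\<Sum>j\<le>m. \<Sum>k=1..j. \<Sum>l=1..h ! (j - k). f (int j, k, Suc g, l))"
    for h and f :: "_ \<Rightarrow> real"
    by (subst sum.reindex[OF inj]) (simp add: T_def sum.Sigma emb_def case_prod_unfold)
  have Zeq: "(\<Sum>j\<le>m. c j * real (generation \<zeta> (Suc g) (int j) \<omega>))
      = (\<Sum>i\<in>emb ` T (H \<omega>). c (nat (fst i)) * real (\<zeta>' i \<omega>))" for \<omega>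
    unfolding sumT
    by (auto simp: Hnth sum_distrib_left of_nat_diff intro!: sum.cong)
  \<comment> \<open>Regrouped by parent, each individual at time \<open>i\<close> collects the
    weights of its possible children, which is the sum in the equation for
    \<open>c i\<close>.\<close>
  have req: "(\<Sum>i\<in>emb ` T (H \<omega>). \<alpha> (fst (snd i)) * (exp (c (nat (fst i))) - 1))
      = (\<Sum>i\<le>m. (\<Sum>k=1..m-i. \<alpha> k * (exp (c (i + k)) - 1)) * real (generation \<zeta> g (int i) \<omega>))" for \<omega>
  proof -
    have "(\<Sum>i\<in>emb ` T (H \<omega>). \<alpha> (fst (snd i)) * (exp (c (nat (fst i))) - 1))
        = (\<Sum>j\<le>m. \<Sum>k=1..j. (\<lambda>i k. \<alpha> k * (exp (c (i + k)) - 1) * real (generation \<zeta> g (int i) \<omega>)) (j - k) k)"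
      unfolding sumT by (auto simp: Hnth intro!: sum.cong)
    also have "\<dots> = (\<Sum>i\<le>m. \<Sum>k=1..m-i. \<alpha> k * (exp (c (i + k)) - 1) * real (generation \<zeta> g (int i) \<omega>))"
      by (rule sum_diff_swap)
    finally show ?thesis by (simp add: sum_distrib_right)
  qed
  have "(\<integral>\<^sup>+\<omega>. ennreal (exp ((\<Sum>h<Suc g. \<Sum>j\<le>m. s j * real (generation \<zeta> h (int j) \<omega>))
            + (\<Sum>j\<le>m. c j * real (generation \<zeta> (Suc g) (int j) \<omega>)))) \<partial>N)
      = (\<integral>\<^sup>+\<omega>. P \<omega> * ennreal (exp (\<Sum>i\<in>emb ` T (H \<omega>). c (nat (fst i)) * real (\<zeta>' i \<omega>))) \<partial>N)"
    unfolding Zeq P_def by (simp only: exp_add ennreal_mult exp_ge_zero)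
  also have "\<dots> = (\<integral>\<^sup>+\<omega>. P \<omega> * ennreal (exp (\<Sum>i\<in>emb ` T (H \<omega>). \<alpha> (fst (snd i)) * (exp (c (nat (fst i))) - 1))) \<partial>N)"
  proof (rule nn_integral_poisson_step[OF indep_\<zeta>, where A=A and B=B and J="\<lambda>h. emb ` T h"])
    show "H \<in> gen_sigma N \<zeta>' A \<rightarrow>\<^sub>M count_space UNIV"
      unfolding H_def by (rule measurable_map_list) (rule gen, simp)
    show "P \<in> borel_measurable (gen_sigma N \<zeta>' A)"
    proof -
      have "(\<lambda>\<omega>. \<Sum>h<Suc g. \<Sum>j\<le>m. s j * real (generation \<zeta> h (int j) \<omega>))
          \<in> borel_measurable (gen_sigma N \<zeta>' A)"
        by (intro borel_measurable_sum borel_measurable_times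
            borel_measurable_const borel_measurable_real_nat gen) (simp add: less_Suc_eq_le)
      then show ?thesis
        unfolding P_def by measurable
    qed
    show "distr N (count_space UNIV) (\<zeta>' i) = measure_pmf (pois (\<alpha> (fst (snd i))))" if "i \<in> B" for i
      using that by (auto simp: B_def distr_\<zeta>)
    show "finite (emb ` T h)" for h by (auto simp: T_def)
    show "emb ` T h \<subseteq> B" for h by (auto simp: T_def B_def emb_def)
  qed (use \<alpha> in \<open>auto simp: A_def B_def\<close>)
  also have "\<dots> = (\<integral>\<^sup>+\<omega>. ennreal (exp ((\<Sum>h<g. \<Sum>j\<le>m. s j * real (generation \<zeta> h (int j) \<omega>))
            + (\<Sum>j\<le>m. c j * real (generation \<zeta> g (int j) \<omega>)))) \<partial>N)"
  proof (rule nn_integral_cong)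
    fix \<omega>
    have "(\<Sum>j\<le>m. s j * real (generation \<zeta> g (int j) \<omega>))
        + (\<Sum>i\<le>m. (\<Sum>k=1..m-i. \<alpha> k * (exp (c (i + k)) - 1)) * real (generation \<zeta> g (int i) \<omega>))
        = (\<Sum>j\<le>m. c j * real (generation \<zeta> g (int j) \<omega>))"
      unfolding sum.distrib[symmetric] by (rule sum.cong) (simp_all add: c distrib_right)
    then show "P \<omega> * ennreal (exp (\<Sum>i\<in>emb ` T (H \<omega>). \<alpha> (fst (snd i)) * (exp (c (nat (fst i))) - 1)))
      = ennreal (exp ((\<Sum>h<g. \<Sum>j\<le>m. s j * real (generation \<zeta> h (int j) \<omega>))
            + (\<Sum>j\<le>m. c j * real (generation \<zeta> g (int j) \<omega>))))"
      unfolding P_def req by (subst ennreal_mult[symmetric]) (simp_all add: exp_add[symmetric] add.assoc)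
  qed
  finally show ?case using Suc.IH by simp
qed

text \<open>Up to time \<open>m\<close> no generation beyond \<open>m\<close> occurs, so for
  \<open>g = Suc m\<close> the invariant of \<open>nn_integral_generation\<close> is the
  moment-generating function itself.\<close>

lemma joint_mgf_family:
  assumes "\<And>k. \<alpha> k \<ge> 0"
    and "\<And>j. j \<le> m \<Longrightarrow> c j = s j + (\<Sum>k=1..m-j. \<alpha> k * (exp (c (j + k)) - 1))"
    and s: "\<And>n. n > m \<Longrightarrow> s n = 0"
  shows "joint_mgf N (family \<zeta>) s = ennreal (exp (c 0))"
proof -
  have "(\<Sum>n. s n * real (family \<zeta> (int n) \<omega>))
      = (\<Sum>h<Suc m. \<Sum>j\<le>m. s j * real (generation \<zeta> h (int j) \<omega>))
            + (\<Sum>j\<le>m. c j * real (generation \<zeta> (Suc m) (int j) \<omega>))" for \<omega>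
  proof -
    have "(\<Sum>n. s n * real (family \<zeta> (int n) \<omega>)) = (\<Sum>n\<le>m. s n * real (family \<zeta> (int n) \<omega>))"
      by (rule suminf_finite) (auto simp: s)
    also have "\<dots> = (\<Sum>n\<le>m. \<Sum>h\<le>m. s n * real (generation \<zeta> h (int n) \<omega>))"
      by (rule sum.cong) (auto simp: family_eq_sum[where m=m] sum_distrib_left)
    also have "\<dots> = (\<Sum>h<Suc m. \<Sum>j\<le>m. s j * real (generation \<zeta> h (int j) \<omega>))"
      by (subst sum.swap) (simp add: lessThan_Suc_atMost)
    moreover have "generation \<zeta> (Suc m) (int j) \<omega> = 0" if "j \<le> m" for j
      by (rule generation_eq_0) (use that in simp)
    then have "(\<Sum>j\<le>m. c j * real (generation \<zeta> (Suc m) (int j) \<omega>)) = 0"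
      by (intro sum.neutral) (simp del: generation.simps)
    ultimately show ?thesis by simp
  qed
  then show ?thesis
    unfolding joint_mgf_def using nn_integral_generation[OF assms(1,2), where g="Suc m"] by simp
qed

end

section \<open>Truncated INAR processes\<close>

text \<open>\<open>inar_trunc \<epsilon> \<xi> n L\<close> is the value at time \<open>n\<close> of the process started from the empty past
  at time \<open>n - L\<close>.\<close>

function inar_trunc ::
  "(int \<Rightarrow> 'a \<Rightarrow> nat) \<Rightarrow> (int \<Rightarrow> nat \<Rightarrow> nat \<Rightarrow> 'a \<Rightarrow> nat) \<Rightarrow> int \<Rightarrow> nat \<Rightarrow> 'a \<Rightarrow> nat" where
  "inar_trunc \<epsilon> \<xi> n L \<omega> =
     \<epsilon> n \<omega> + (\<Sum>k\<in>{1..L}. \<Sum>l=1..inar_trunc \<epsilon> \<xi> (n - int k) (L - k) \<omega>. \<xi> n k l \<omega>)"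
  by auto
termination by (relation "Wellfounded.measure (\<lambda>(\<epsilon>, \<xi>, n, L, \<omega>). L)") auto

declare inar_trunc.simps [simp del]

lemma inar_trunc_measurable:
  assumes "\<And>n'. n' \<le> n \<Longrightarrow> \<epsilon> n' \<in> M' \<rightarrow>\<^sub>M count_space UNIV"
    and "\<And>n' k l. n' \<le> n \<Longrightarrow> k \<ge> 1 \<Longrightarrow> l \<ge> 1 \<Longrightarrow> \<xi> n' k l \<in> M' \<rightarrow>\<^sub>M count_space UNIV"
  shows "inar_trunc \<epsilon> \<xi> n L \<in> M' \<rightarrow>\<^sub>M count_space UNIV"
  using assms
proof (induction L arbitrary: n rule: less_induct)
  case (less L)
  have IH: "inar_trunc \<epsilon> \<xi> (n - int k) (L - k) \<in> M' \<rightarrow>\<^sub>M count_space UNIV" if "k \<in> {1..L}" for k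
    using that by (intro less.IH less.prems) auto
  have "(\<lambda>\<omega>. \<Sum>l=1..inar_trunc \<epsilon> \<xi> (n - int k) (L - k) \<omega>. \<xi> n k l \<omega>) \<in> M' \<rightarrow>\<^sub>M count_space UNIV"
    if "k \<in> {1..L}" for k
    by (rule measurable_nat_random_sum) (use less.prems that IH in auto)
  then have "(\<lambda>\<omega>. \<epsilon> n \<omega> + (\<Sum>k\<in>{1..L}. \<Sum>l=1..inar_trunc \<epsilon> \<xi> (n - int k) (L - k) \<omega>. \<xi> n k l \<omega>))
      \<in> M' \<rightarrow>\<^sub>M count_space UNIV"
    by (intro measurable_nat_add measurable_nat_sum less.prems) auto
  moreover have "inar_trunc \<epsilon> \<xi> n L
      = (\<lambda>\<omega>. \<epsilon> n \<omega> + (\<Sum>k\<in>{1..L}. \<Sum>l=1..inar_trunc \<epsilon> \<xi> (n - int k) (L - k) \<omega>. \<xi> n k l \<omega>))"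
    by (rule ext) (rule inar_trunc.simps)
  ultimately show ?case by simp
qed

context inar_noise
begin

abbreviation "noise \<equiv> case_sum \<epsilon> (\<lambda>(n, k, l). \<xi> n k l)"
abbreviation "noise_index \<equiv> (UNIV <+> (UNIV \<times> {1..} \<times> {1..}) :: (int + int \<times> nat \<times> nat) set)"
abbreviation "noise_time \<equiv> (case_sum id fst :: int + int \<times> nat \<times> nat \<Rightarrow> int)"
abbreviation "U \<equiv> inar_trunc \<epsilon> \<xi>"

lemma indep_noise': "indep_vars (\<lambda>_. count_space UNIV) noise noise_index"
  using indep_noise .

lemma noise_measurable: "i \<in> noise_index \<Longrightarrow> noise i \<in> M \<rightarrow>\<^sub>M count_space UNIV"
  using indep_noise' unfolding indep_vars_def by blast

lemma \<epsilon>_measurable: "\<epsilon> n \<in> M \<rightarrow>\<^sub>M count_space UNIV"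
  using noise_measurable[OF InlI[OF UNIV_I]] by simp

lemma \<xi>_measurable: "k \<ge> 1 \<Longrightarrow> l \<ge> 1 \<Longrightarrow> \<xi> n k l \<in> M \<rightarrow>\<^sub>M count_space UNIV"
  using noise_measurable[of "Inr (n, k, l)"] by auto

lemma U_measurable: "U n L \<in> M \<rightarrow>\<^sub>M count_space UNIV"
  by (rule inar_trunc_measurable[OF \<epsilon>_measurable \<xi>_measurable])

lemma inar_trunc_gen_sigma:
  assumes "\<And>i. i \<in> noise_index \<Longrightarrow> noise_time i \<le> n \<Longrightarrow> i \<in> A"
  shows "U n L \<in> gen_sigma M noise A \<rightarrow>\<^sub>M count_space UNIV"
proof (rule inar_trunc_measurable)
  fix n' assume "n' \<le> n"
  then have "noise (Inl n') \<in> gen_sigma M noise A \<rightarrow>\<^sub>M count_space UNIV"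
    by (intro measurable_gen_sigma assms) auto
  then show "\<epsilon> n' \<in> gen_sigma M noise A \<rightarrow>\<^sub>M count_space UNIV" by simp
next
  fix n' and k l :: nat assume "n' \<le> n" "k \<ge> 1" "l \<ge> 1"
  then have "noise (Inr (n', k, l)) \<in> gen_sigma M noise A \<rightarrow>\<^sub>M count_space UNIV"
    by (intro measurable_gen_sigma assms) auto
  then show "\<xi> n' k l \<in> gen_sigma M noise A \<rightarrow>\<^sub>M count_space UNIV" by simp
qed

text \<open>The values \<open>U (s + int j) j\<close> all belong to one process started at time
  \<open>s\<close>, so each is a finite sum over the preceding ones. The induction hypothesis
  describes what remains when the times from \<open>i\<close> on have been eliminated; the step
  undoes one elimination, and at \<open>i = Suc m\<close> none is left.\<close>

lemma nn_integral_inar_trunc: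
  assumes \<alpha>: "\<And>k. \<alpha> k \<ge> 0"
    and c: "\<And>j. j \<le> m \<Longrightarrow> c j = t j + (\<Sum>k=1..m-j. \<alpha> k * (exp (c (j + k)) - 1))"
  shows "(\<integral>\<^sup>+\<omega>. ennreal (exp (\<Sum>j\<le>m. t j * real (U (s + int j) j \<omega>))) \<partial>M)
       = ennreal (exp (\<alpha> 0 * (\<Sum>j\<le>m. exp (c j) - 1)))"
proof -
  define a where "a j = exp (c j) - 1" for j
  \<comment> \<open>coefficient of \<open>U (s + int j) j\<close> once all times from \<open>i\<close> on are integrated out\<close>
  define q where "q i j = t j + (\<Sum>k | k \<in> {1..m-j} \<and> i \<le> j + k. \<alpha> k * a (j + k))" for i j
  have "(\<integral>\<^sup>+\<omega>. ennreal (exp (\<Sum>j<i. q i j * real (U (s + int j) j \<omega>))) \<partial>M)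
       = ennreal (exp (\<alpha> 0 * (\<Sum>j<i. a j)))" if "i \<le> Suc m" for i
    using that
  proof (induction i)
    case 0
    then show ?case by (simp add: emeasure_space_1)
  next
    case (Suc i)
    define A where "A = {x \<in> noise_index. noise_time x < s + int i}"
    define B where "B = {x \<in> noise_index. noise_time x = s + int i}"
    define H where "H = (\<lambda>\<omega>. map (\<lambda>j. U (s + int j) j \<omega>) [0..<i])"
    \<comment> \<open>Lags up to \<open>i\<close> reach back exactly to the starting time;
      \<open>h ! (i - k)\<close> is the number of parents at lag \<open>k\<close>.\<close>
    define T where "T = (\<lambda>h::nat list. SIGMA k:{1..i}. {1..h ! (i - k)})"
    define emb :: "nat \<times> nat \<Rightarrow> int + int \<times> nat \<times> nat"
      where "emb = (\<lambda>(k,l). Inr (s + int i, k, l))"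
    define J where "J = (\<lambda>h. insert (Inl (s + int i)) (emb ` T h))"
    define r where "r = case_sum (\<lambda>_::int. \<alpha> 0) (\<lambda>(_::int, k, _::nat). \<alpha> k)"
    define P where "P = (\<lambda>\<omega>. ennreal (exp (\<Sum>j<i. q (Suc i) j * real (U (s + int j) j \<omega>))))"
    have inj: "inj_on emb X" for X by (auto simp: inj_on_def emb_def)
    have gen: "U (s + int j) j \<in> gen_sigma M noise A \<rightarrow>\<^sub>M count_space UNIV" if "j < i" for j
      by (rule inar_trunc_gen_sigma) (use that in \<open>auto simp: A_def\<close>)
    have Hnth: "H \<omega> ! j = U (s + int j) j \<omega>" if "j < i" for j \<omega>
      using that by (simp add: H_def)
    have sumJ: "(\<Sum>x\<in>J h. f x) = f (Inl (s + int i)) + (\<Sum>k=1..i. \<Sum>l=1..h ! (i - k). f (Inr (s + int i, k, l)))"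
      for h and f :: "_ \<Rightarrow> real"
    proof -
      have "(\<Sum>x\<in>emb ` T h. f x) = (\<Sum>k=1..i. \<Sum>l=1..h ! (i - k). f (Inr (s + int i, k, l)))"
        by (subst sum.reindex[OF inj]) (simp add: T_def sum.Sigma emb_def case_prod_unfold)
      moreover have "finite (T h)" "Inl (s + int i) \<notin> emb ` T h" by (auto simp: T_def emb_def)
      ultimately show ?thesis by (simp add: J_def)
    qed
    \<comment> \<open>Lags are at least 1, so the condition \<open>Suc i \<le> i + k\<close>
      excludes none, and \<open>q\<close> is the full right-hand side of the equation for
      \<open>c i\<close>.\<close>
    have qi: "q (Suc i) i = c i"
    proof -
      have "{k. k \<in> {1..m-i} \<and> Suc i \<le> i + k} = {1..m-i}" by auto
      then show ?thesis using c[of i] Suc.prems by (simp add: q_def a_def)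
    qed
    \<comment> \<open>Eliminating time \<open>i\<close> adds the single lag
      \<open>k = i - j\<close>.\<close>
    have qS: "q i j = q (Suc i) j + \<alpha> (i - j) * a i" if "j < i" for j
    proof -
      have "{k. k \<in> {1..m-j} \<and> i \<le> j + k} = insert (i - j) {k. k \<in> {1..m-j} \<and> Suc i \<le> j + k}"
        using that Suc.prems by auto
      moreover have "i - j \<notin> {k. k \<in> {1..m-j} \<and> Suc i \<le> j + k}" using that by auto
      ultimately show ?thesis using that by (simp add: q_def)
    qed
    have Zeq: "(\<Sum>j<Suc i. q (Suc i) j * real (U (s + int j) j \<omega>))
        = (\<Sum>j<i. q (Suc i) j * real (U (s + int j) j \<omega>)) + (\<Sum>x\<in>J (H \<omega>). c i * real (noise x \<omega>))" for \<omega>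
    proof -
      have "real (U (s + int i) i \<omega>) = (\<Sum>x\<in>J (H \<omega>). real (noise x \<omega>))"
        unfolding sumJ by (subst inar_trunc.simps) (auto simp: Hnth of_nat_diff algebra_simps intro!: sum.cong)
      then show ?thesis by (simp add: qi sum_distrib_left)
    qed
    have req: "(\<Sum>x\<in>J (H \<omega>). r x * (exp (c i) - 1))
        = \<alpha> 0 * a i + (\<Sum>j<i. \<alpha> (i - j) * a i * real (U (s + int j) j \<omega>))" for \<omega>
    proof -
      have "(\<Sum>k=1..i. \<Sum>l=1..H \<omega> ! (i - k). \<alpha> k * a i)
          = (\<Sum>k=1..i. \<alpha> k * a i * real (U (s + int (i - k)) (i - k) \<omega>))"
        by (rule sum.cong) (auto simp: Hnth)
      also have "\<dots> = (\<Sum>j<i. \<alpha> (i - j) * a i * real (U (s + int j) j \<omega>))"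
        by (rule sum.reindex_bij_witness[of _ "\<lambda>j. i - j" "\<lambda>k. i - k"]) auto
      finally show ?thesis
        unfolding sumJ by (simp add: r_def a_def)
    qed
    have "(\<integral>\<^sup>+\<omega>. ennreal (exp (\<Sum>j<Suc i. q (Suc i) j * real (U (s + int j) j \<omega>))) \<partial>M)
        = (\<integral>\<^sup>+\<omega>. P \<omega> * ennreal (exp (\<Sum>x\<in>J (H \<omega>). c i * real (noise x \<omega>))) \<partial>M)"
      unfolding Zeq P_def by (simp only: exp_add ennreal_mult exp_ge_zero)
    also have "\<dots> = (\<integral>\<^sup>+\<omega>. P \<omega> * ennreal (exp (\<Sum>x\<in>J (H \<omega>). r x * (exp (c i) - 1))) \<partial>M)"
    proof (rule nn_integral_poisson_step[OF indep_noise', where A=A and B=B and J=J])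
      show "H \<in> gen_sigma M noise A \<rightarrow>\<^sub>M count_space UNIV"
        unfolding H_def by (rule measurable_map_list) (rule gen, simp)
      show "P \<in> borel_measurable (gen_sigma M noise A)"
      proof -
        have "(\<lambda>\<omega>. \<Sum>j<i. q (Suc i) j * real (U (s + int j) j \<omega>)) \<in> borel_measurable (gen_sigma M noise A)"
          by (intro borel_measurable_sum borel_measurable_times
              borel_measurable_const borel_measurable_real_nat gen) simp
        then show ?thesis
          unfolding P_def by measurable
      qed
      show "distr M (count_space UNIV) (noise x) = measure_pmf (pois (r x))" if "x \<in> B" for x
        using that by (auto simp: B_def r_def distr_\<epsilon> distr_\<xi>)
      show "finite (J h)" for h by (auto simp: T_def J_def)
      show "J h \<subseteq> B" for h by (auto simp: T_def B_def J_def emb_def)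
      show "r x \<ge> 0" for x using \<alpha> by (auto simp: r_def split: sum.split)
    qed (auto simp: A_def B_def)
    also have "\<dots> = (\<integral>\<^sup>+\<omega>. ennreal (exp (\<alpha> 0 * a i)) * ennreal (exp (\<Sum>j<i. q i j * real (U (s + int j) j \<omega>))) \<partial>M)"
    proof (rule nn_integral_cong)
      fix \<omega>
      have "(\<Sum>j<i. q (Suc i) j * real (U (s + int j) j \<omega>))
          + (\<Sum>j<i. \<alpha> (i - j) * a i * real (U (s + int j) j \<omega>)) = (\<Sum>j<i. q i j * real (U (s + int j) j \<omega>))"
        unfolding sum.distrib[symmetric] by (rule sum.cong) (simp_all add: qS distrib_right)
      then show "P \<omega> * ennreal (exp (\<Sum>x\<in>J (H \<omega>). r x * (exp (c i) - 1)))
          = ennreal (exp (\<alpha> 0 * a i)) * ennreal (exp (\<Sum>j<i. q i j * real (U (s + int j) j \<omega>)))"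
        unfolding P_def req by (simp add: ennreal_mult[symmetric] exp_add[symmetric] algebra_simps)
    qed
    also have "\<dots> = ennreal (exp (\<alpha> 0 * a i)) * (\<integral>\<^sup>+\<omega>. ennreal (exp (\<Sum>j<i. q i j * real (U (s + int j) j \<omega>))) \<partial>M)"
    proof (rule nn_integral_cmult)
      have "(\<lambda>\<omega>. \<Sum>j<i. q i j * real (U (s + int j) j \<omega>)) \<in> borel_measurable M"
        by (intro borel_measurable_sum borel_measurable_times
            borel_measurable_const borel_measurable_real_nat U_measurable)
      then show "(\<lambda>\<omega>. ennreal (exp (\<Sum>j<i. q i j * real (U (s + int j) j \<omega>)))) \<in> borel_measurable M"
        by measurable
    qed
    also have "\<dots> = ennreal (exp (\<alpha> 0 * (\<Sum>j<Suc i. a j)))"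
      using Suc by (simp add: ennreal_mult[symmetric] exp_add[symmetric] algebra_simps)
    finally show ?case .
  qed
  from this[of "Suc m"]
  show ?thesis
  proof -
    \<comment> \<open>No admissible lag reaches beyond \<open>m\<close>, so only the original
      exponents are left.\<close>
    have "{k. k \<in> {1..m-j} \<and> Suc m \<le> j + k} = {}" if "j \<le> m" for j using that by auto
    then have "q (Suc m) j = t j" if "j \<le> m" for j using that unfolding q_def by (metis add_0_right sum.empty)
    then have "(\<Sum>j\<le>m. q (Suc m) j * real (U (s + int j) j \<omega>)) = (\<Sum>j\<le>m. t j * real (U (s + int j) j \<omega>))" for \<omega>
      by (intro sum.cong) auto
    with \<open>Suc m \<le> Suc m \<Longrightarrow> _\<close> show ?thesis
      by (simp add: lessThan_Suc_atMost a_def)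
  qed
qed

end

section \<open>Bounds for the exponents\<close>

text \<open>The logarithm of the family's moment-generating function at \<open>s\<close>, provided
  that \<open>s\<close> vanishes beyond \<open>m\<close>. The horizon makes the recursion terminate:
  a shift by \<open>k\<close> leaves the horizon \<open>m - k\<close>.\<close>

function cgf :: "(nat \<Rightarrow> real) \<Rightarrow> nat \<Rightarrow> (nat \<Rightarrow> real) \<Rightarrow> real" where
  "cgf \<alpha> m s = s 0 + (\<Sum>k\<in>{1..m}. \<alpha> k * (exp (cgf \<alpha> (m - k) (\<lambda>n. s (n + k))) - 1))"
  by auto
termination by (relation "Wellfounded.measure (\<lambda>(\<alpha>, m, s). m)") auto

declare cgf.simps [simp del]

text \<open>With \<open>c j\<close> for the left-hand side, this is the equation required of the
  exponents \<open>c\<close> in the integral formulas and the bounds.\<close>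

lemma cgf_shift:
  "cgf \<alpha> (m - j) (\<lambda>n. s (n + j))
     = s j + (\<Sum>k=1..m-j. \<alpha> k * (exp (cgf \<alpha> (m - (j + k)) (\<lambda>n. s (n + (j + k)))) - 1))"
  by (subst cgf.simps) (simp add: ac_simps)

text \<open>After summation over \<open>j\<close>, each \<open>q j\<close> occurs on the right with
  weight at most \<open>\<rho> * K\<close>, which is below 1 and can be absorbed on the
  left.\<close>

lemma sum_le_renewal:
  fixes q w \<alpha> :: "nat \<Rightarrow> real"
  assumes \<alpha>: "\<And>k. \<alpha> k \<ge> 0" and K: "\<And>n. (\<Sum>k=1..n. \<alpha> k) \<le> K"
    and q: "\<And>j. q j \<ge> 0" and \<rho>: "\<rho> \<ge> 0" "\<rho> * K < 1"
    and le: "\<And>j. j \<le> m \<Longrightarrow> q j \<le> \<rho> * (\<Sum>k=1..m-j. \<alpha> k * q (j + k)) + w j"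
  shows "(\<Sum>j\<le>m. q j) \<le> (\<Sum>j\<le>m. w j) / (1 - \<rho> * K)"
proof -
  have "(\<Sum>j\<le>m. \<Sum>k=1..m-j. \<alpha> k * q (j + k)) = (\<Sum>j\<le>m. \<Sum>k=1..j. \<alpha> k * q (j - k + k))"
    by (rule sum_diff_swap[symmetric])
  also have "\<dots> = (\<Sum>j\<le>m. (\<Sum>k=1..j. \<alpha> k) * q j)"
    by (intro sum.cong) (auto simp: sum_distrib_right)
  also have "\<dots> \<le> (\<Sum>j\<le>m. K * q j)"
    by (intro sum_mono mult_right_mono K q)
  finally have *: "(\<Sum>j\<le>m. \<Sum>k=1..m-j. \<alpha> k * q (j + k)) \<le> K * (\<Sum>j\<le>m. q j)"
    by (simp add: sum_distrib_left)
  have "(\<Sum>j\<le>m. q j) \<le> (\<Sum>j\<le>m. \<rho> * (\<Sum>k=1..m-j. \<alpha> k * q (j + k)) + w j)"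
    by (intro sum_mono le) simp
  also have "\<dots> = \<rho> * (\<Sum>j\<le>m. \<Sum>k=1..m-j. \<alpha> k * q (j + k)) + (\<Sum>j\<le>m. w j)"
    by (simp add: sum.distrib sum_distrib_left)
  also have "\<dots> \<le> \<rho> * (K * (\<Sum>j\<le>m. q j)) + (\<Sum>j\<le>m. w j)"
    using * \<rho>(1) by (simp add: mult_left_mono)
  finally have "(\<Sum>j\<le>m. q j) * (1 - \<rho> * K) \<le> (\<Sum>j\<le>m. w j)"
    by (simp add: algebra_simps)
  then show ?thesis
    using \<rho>(2) by (simp add: pos_le_divide_eq)
qed

lemma exp_minus_1_le: "exp x - 1 \<le> x * exp (x::real)"
proof -
  have "(1 - x) * exp x \<le> exp (- x) * exp x"
    using exp_ge_add_one_self[of "- x"] by (intro mult_right_mono) auto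
  then show ?thesis by (simp add: exp_add[symmetric] algebra_simps)
qed

section \<open>Bounds for single weights and for their sums\<close>

context
  fixes \<alpha> t c :: "nat \<Rightarrow> real" and K b \<delta> :: real and m :: nat
  assumes \<alpha>: "\<And>k. \<alpha> k \<ge> 0" and K: "\<And>n. (\<Sum>k=1..n. \<alpha> k) \<le> K"
    and b: "0 \<le> b" and \<delta>: "0 \<le> \<delta>" and small: "exp (\<delta> + K * b) \<le> 1 + b"
    and t: "\<And>j. t j \<le> \<delta>"
    and c: "\<And>j. j \<le> m \<Longrightarrow> c j = t j + (\<Sum>k=1..m-j. \<alpha> k * (exp (c (j + k)) - 1))"
begin

lemma sum_weights_le: "(\<And>k. k \<in> {1..n} \<Longrightarrow> x k \<le> b) \<Longrightarrow> (\<Sum>k=1..n. \<alpha> k * x k) \<le> K * b"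
proof -
  assume "\<And>k. k \<in> {1..n} \<Longrightarrow> x k \<le> b"
  then have "(\<Sum>k=1..n. \<alpha> k * x k) \<le> (\<Sum>k=1..n. \<alpha> k * b)"
    by (intro sum_mono mult_left_mono \<alpha>)
  also have "\<dots> \<le> K * b"
    unfolding sum_distrib_right[symmetric] by (intro mult_right_mono K b)
  finally show ?thesis .
qed

text \<open>Induction from the last time backwards: \<open>small\<close> turns the bound
  \<open>b\<close> on the later weights into the same bound at \<open>j\<close>.\<close>

lemma cumulant_le: "j \<le> m \<Longrightarrow> exp (c j) - 1 \<le> b"
proof (induction "m - j" arbitrary: j rule: less_induct)
  case less
  have "(\<Sum>k=1..m-j. \<alpha> k * (exp (c (j + k)) - 1)) \<le> K * b"
    by (rule sum_weights_le, rule less.hyps) (use less.prems in auto)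
  then have "c j \<le> \<delta> + K * b"
    using c[OF less.prems] t[of j] by linarith
  then have "exp (c j) \<le> exp (\<delta> + K * b)" by simp
  with small show ?case by linarith
qed

text \<open>A renewal inequality with factor \<open>1 + b\<close>: adding the offspring part
  \<open>X\<close> to an exponent \<tau> raises its exponential by at most
  \<open>X * exp (\<tau> + X)\<close>, and this exponential is at most \<open>1 + b\<close>. Only
  places with nonzero \<open>t j\<close> contribute a source term.\<close>

lemma sum_pos_cumulant_le:
  assumes "(1 + b) * K < 1"
  shows "(\<Sum>j\<le>m. max 0 (exp (c j) - 1))
    \<le> real (card {j. j \<le> m \<and> t j \<noteq> 0}) * (exp \<delta> - 1) / (1 - (1 + b) * K)"
proof -
  define p where "p j = max 0 (exp (c j) - 1)" for j
  define w where "w j = (if t j = 0 then 0 else exp \<delta> - 1)" for j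
  have "(\<Sum>j\<le>m. p j) \<le> (\<Sum>j\<le>m. w j) / (1 - (1 + b) * K)"
  proof (rule sum_le_renewal[OF \<alpha> K])
    show "p j \<ge> 0" for j by (simp add: p_def)
    fix j assume j: "j \<le> m"
    define X where "X = (\<Sum>k=1..m-j. \<alpha> k * p (j + k))"
    \<comment> \<open>A negative \<open>t j\<close> may be raised to \<delta>, but where
      \<open>t j = 0\<close> the value must stay 0 for the source term to vanish.\<close>
    define \<tau> where "\<tau> = (if t j = 0 then 0 else \<delta>)"
    have "(\<Sum>k=1..m-j. \<alpha> k * (exp (c (j + k)) - 1)) \<le> X"
      unfolding X_def p_def by (intro sum_mono mult_left_mono \<alpha>) simp
    moreover have "t j \<le> \<tau>" "\<tau> \<le> \<delta>" using t[of j] \<delta> by (auto simp: \<tau>_def)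
    moreover have "X \<le> K * b"
      unfolding X_def by (rule sum_weights_le) (use j b cumulant_le in \<open>auto simp: p_def\<close>)
    moreover have X0: "X \<ge> 0"
      unfolding X_def p_def by (intro sum_nonneg mult_nonneg_nonneg \<alpha>) simp
    ultimately have "c j \<le> \<tau> + X" and "\<tau> + X \<le> \<delta> + K * b"
      using c[OF j] by linarith+
    then have cj: "exp (c j) \<le> exp (\<tau> + X)" and tX: "exp (\<tau> + X) \<le> 1 + b"
      using small by (simp, smt (verit) exp_le_cancel_iff)
    have "exp \<tau> * (exp X - 1) \<le> exp \<tau> * (X * exp X)"
      by (intro mult_left_mono exp_minus_1_le) simp
    also have "\<dots> = X * exp (\<tau> + X)" by (simp add: exp_add)
    also have "\<dots> \<le> X * (1 + b)" by (intro mult_left_mono tX X0)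
    finally have "exp (\<tau> + X) - exp \<tau> \<le> (1 + b) * X"
      by (simp add: exp_add algebra_simps)
    moreover have "exp \<tau> - 1 = w j" by (simp add: w_def \<tau>_def)
    ultimately have "exp (c j) - 1 \<le> (1 + b) * X + w j"
      using cj by linarith
    moreover have "w j \<ge> 0" using \<delta> by (simp add: w_def)
    ultimately show "p j \<le> (1 + b) * (\<Sum>k=1..m-j. \<alpha> k * p (j + k)) + w j"
      using X0 b unfolding p_def X_def by simp
  qed (use b assms in auto)
  moreover have "(\<Sum>j\<le>m. w j) = real (card {j. j \<le> m \<and> t j \<noteq> 0}) * (exp \<delta> - 1)"
  proof -
    have "(\<Sum>j\<le>m. w j) = (\<Sum>j | j \<le> m \<and> t j \<noteq> 0. exp \<delta> - 1)"
      unfolding w_def by (rule sum.mono_neutral_cong_right) auto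
    then show ?thesis by simp
  qed
  ultimately show ?thesis by (simp add: p_def)
qed

text \<open>Exponents are not bounded below, so where \<open>t j\<close> is nonzero its size is of
  no help; there the weight lies between -1 and \<open>b \<le> 1\<close>, and the source term is 1.
  Elsewhere \<open>exp\<close> is Lipschitz with constant \<open>1 + b\<close> on the range that
  occurs.\<close>

lemma sum_abs_cumulant_le:
  assumes "(1 + b) * K < 1" and b1: "b \<le> 1"
  shows "(\<Sum>j\<le>m. \<bar>exp (c j) - 1\<bar>) \<le> real (card {j. j \<le> m \<and> t j \<noteq> 0}) / (1 - (1 + b) * K)"
proof -
  define q where "q j = \<bar>exp (c j) - 1\<bar>" for j
  define w :: "nat \<Rightarrow> real" where "w j = (if t j = 0 then 0 else 1)" for j
  have "(\<Sum>j\<le>m. q j) \<le> (\<Sum>j\<le>m. w j) / (1 - (1 + b) * K)"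
  proof (rule sum_le_renewal[OF \<alpha> K])
    show "q j \<ge> 0" for j by (simp add: q_def)
    fix j assume j: "j \<le> m"
    define x where "x = (\<Sum>k=1..m-j. \<alpha> k * (exp (c (j + k)) - 1))"
    define X where "X = (\<Sum>k=1..m-j. \<alpha> k * q (j + k))"
    have "\<bar>x\<bar> \<le> (\<Sum>k=1..m-j. \<bar>\<alpha> k * (exp (c (j + k)) - 1)\<bar>)"
      unfolding x_def by (rule sum_abs)
    also have "\<dots> = X"
      unfolding X_def q_def by (intro sum.cong) (auto simp: abs_mult \<alpha>)
    finally have xX: "\<bar>x\<bar> \<le> X" .
    have "x \<le> K * b"
      unfolding x_def by (rule sum_weights_le) (use j cumulant_le in auto)
    then have "exp x \<le> exp (\<delta> + K * b)" using \<delta> by simp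
    then have ex: "exp x \<le> 1 + b" using small by linarith
    show "q j \<le> (1 + b) * (\<Sum>k=1..m-j. \<alpha> k * q (j + k)) + w j"
    proof (cases "t j = 0")
      case True
      then have cx: "c j = x" using c[OF j] by (simp add: x_def)
      have "\<bar>exp x - 1\<bar> \<le> (1 + b) * \<bar>x\<bar>"
      proof (cases "x \<ge> 0")
        case True
        have "exp x - 1 \<le> x * exp x" by (rule exp_minus_1_le)
        also have "\<dots> \<le> x * (1 + b)" by (rule mult_left_mono[OF ex True])
        finally show ?thesis using True by (simp add: mult.commute)
      next
        case False
        then have "\<bar>exp x - 1\<bar> \<le> \<bar>x\<bar>"
          using exp_ge_add_one_self[of x] exp_le_one_iff[of x] by linarith
        also have "\<dots> \<le> (1 + b) * \<bar>x\<bar>" using b by (simp add: mult_le_cancel_right1)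
        finally show ?thesis .
      qed
      also have "\<dots> \<le> (1 + b) * X" using xX b by (intro mult_left_mono) auto
      finally show ?thesis using True by (simp add: q_def cx w_def X_def)
    next
      case False
      have "q j \<le> 1"
        using cumulant_le[OF j] b1 exp_gt_zero[of "c j"] unfolding q_def abs_le_iff by linarith
      moreover have "(1 + b) * X \<ge> 0" using xX b by simp
      ultimately show ?thesis using False by (simp add: w_def X_def)
    qed
  qed (use b assms in auto)
  moreover have "(\<Sum>j\<le>m. w j) = real (card {j. j \<le> m \<and> t j \<noteq> 0})"
  proof -
    have "(\<Sum>j\<le>m. w j) = (\<Sum>j | j \<le> m \<and> t j \<noteq> 0. 1)"
      unfolding w_def by (rule sum.mono_neutral_cong_right) auto
    then show ?thesis by simp
  qed
  ultimately show ?thesis by (simp add: q_def)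
qed

end

text \<open>With \<open>b = (1 - K) / 2\<close> and \<open>\<delta> = b\<^sup>2\<close> one has \<open>\<delta> + K b = b - b\<^sup>2 \<le> ln (1 + b)\<close> and
  \<open>1 - (1 + b) K = b (1 + 2 b)\<close>.\<close>

lemma radius_bounds:
  fixes K :: real
  assumes K: "0 \<le> K" "K < 1"
  defines "b \<equiv> (1 - K) / 2"
  shows "0 < b" "b \<le> 1" "exp (b\<^sup>2 + K * b) \<le> 1 + b" "(1 + b) * K < 1"
    "(exp (b\<^sup>2) - 1) / (1 - (1 + b) * K) \<le> 1"
proof -
  show b: "0 < b" "b \<le> 1" using K by (auto simp: b_def)
  have Kb: "K = 1 - 2 * b" by (simp add: b_def field_simps)
  have "b\<^sup>2 + K * b = b - b\<^sup>2" unfolding Kb by (simp add: power2_eq_square algebra_simps)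
  also have "\<dots> \<le> ln (1 + b)" by (rule ln_one_plus_pos_lower_bound) (use b in auto)
  finally have "exp (b\<^sup>2 + K * b) \<le> exp (ln (1 + b))" by simp
  then show "exp (b\<^sup>2 + K * b) \<le> 1 + b" using b by simp
  have den: "1 - (1 + b) * K = b * (1 + 2 * b)" unfolding Kb by (simp add: algebra_simps)
  have "b * (1 + 2 * b) > 0" using b by simp
  with den show "(1 + b) * K < 1" by linarith
  have b2: "0 \<le> b\<^sup>2" "b\<^sup>2 \<le> 1" using b by (auto simp: power_le_one)
  have "(b\<^sup>2)\<^sup>2 \<le> b\<^sup>2" 
    unfolding power2_eq_square[of "b\<^sup>2"] by (rule mult_left_le[OF b2(2,1)])
  \<comment> \<open>\<open>exp_bound\<close> is \<open>exp x \<le> 1 + x + x\<^sup>2\<close>, used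
    at \<open>x = b\<^sup>2\<close>, where the last term is at most \<open>x\<close>.\<close>
  then have "exp (b\<^sup>2) - 1 \<le> 2 * b\<^sup>2" using exp_bound[OF b2] by linarith
  also have "\<dots> \<le> b * (1 + 2 * b)" using b by (simp add: power2_eq_square algebra_simps)
  finally show "(exp (b\<^sup>2) - 1) / (1 - (1 + b) * K) \<le> 1"
    unfolding den using \<open>b * (1 + 2 * b) > 0\<close> by (simp add: divide_le_eq_1)
qed

section \<open>The stationary solution\<close>

lemma inar_trunc_mono_Suc: "inar_trunc \<epsilon> \<xi> n L \<omega> \<le> inar_trunc \<epsilon> \<xi> n (Suc L) \<omega>"
proof (induction L arbitrary: n rule: less_induct)
  case (less L)
  have "(\<Sum>k\<in>{1..L}. \<Sum>l=1..inar_trunc \<epsilon> \<xi> (n - int k) (L - k) \<omega>. \<xi> n k l \<omega>)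
      \<le> (\<Sum>k\<in>{1..L}. \<Sum>l=1..inar_trunc \<epsilon> \<xi> (n - int k) (Suc L - k) \<omega>. \<xi> n k l \<omega>)"
  proof (rule sum_mono)
    fix k assume k: "k \<in> {1..L}"
    have "inar_trunc \<epsilon> \<xi> (n - int k) (L - k) \<omega> \<le> inar_trunc \<epsilon> \<xi> (n - int k) (Suc L - k) \<omega>"
      using less.IH[of "L - k" "n - int k"] k by (simp add: Suc_diff_le)
    then show "(\<Sum>l=1..inar_trunc \<epsilon> \<xi> (n - int k) (L - k) \<omega>. \<xi> n k l \<omega>)
        \<le> (\<Sum>l=1..inar_trunc \<epsilon> \<xi> (n - int k) (Suc L - k) \<omega>. \<xi> n k l \<omega>)"
      by (intro sum_mono2) auto
  qed
  also have "\<dots> \<le> (\<Sum>k\<in>{1..Suc L}. \<Sum>l=1..inar_trunc \<epsilon> \<xi> (n - int k) (Suc L - k) \<omega>. \<xi> n k l \<omega>)"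
    by (rule sum_mono2) auto
  finally show ?case
    unfolding inar_trunc.simps[of \<epsilon> \<xi> n L] inar_trunc.simps[of \<epsilon> \<xi> n "Suc L"]
    by (rule add_left_mono)
qed

lemma incseq_inar_trunc: "incseq (\<lambda>L. inar_trunc \<epsilon> \<xi> n L \<omega>)"
  by (rule incseq_SucI) (rule inar_trunc_mono_Suc)

text \<open>Two noise systems on possibly different sample spaces are compared, because the proof of
  stationarity matches time-shifted noise with coordinates on a product space.\<close>

lemma inar_trunc_shift:
  assumes "\<And>n. \<epsilon> (n + h) \<omega> = \<epsilon>' n \<omega>'"
    and "\<And>n k l. k \<ge> 1 \<Longrightarrow> l \<ge> 1 \<Longrightarrow> \<xi> (n + h) k l \<omega> = \<xi>' n k l \<omega>'"
  shows "inar_trunc \<epsilon> \<xi> (n + h) L \<omega> = inar_trunc \<epsilon>' \<xi>' n L \<omega>'"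
proof (induction L arbitrary: n rule: less_induct)
  case (less L)
  have "inar_trunc \<epsilon> \<xi> (n + h - int k) (L - k) \<omega> = inar_trunc \<epsilon>' \<xi>' (n - int k) (L - k) \<omega>'"
    if "k \<in> {1..L}" for k
    using less.IH[of "L - k" "n - int k"] that by (simp add: algebra_simps)
  then show ?case
    unfolding inar_trunc.simps[of \<epsilon> \<xi> "n + h" L] inar_trunc.simps[of \<epsilon>' \<xi>' n L]
    by (intro arg_cong2[of _ _ _ _ "(+)"] sum.cong assms) auto
qed

text \<open>The limit is junk if the truncations are unbounded, which has probability \<open>0\<close>.\<close>

definition inar_limit ::
  "(int \<Rightarrow> 'a \<Rightarrow> nat) \<Rightarrow> (int \<Rightarrow> nat \<Rightarrow> nat \<Rightarrow> 'a \<Rightarrow> nat) \<Rightarrow> int \<Rightarrow> 'a \<Rightarrow> nat" where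
  "inar_limit \<epsilon> \<xi> n \<omega> = nat \<lfloor>lim (\<lambda>L. real (inar_trunc \<epsilon> \<xi> n L \<omega>))\<rfloor>"

lemma inar_limit_measurable:
  assumes "\<And>n'. n' \<le> n \<Longrightarrow> \<epsilon> n' \<in> M' \<rightarrow>\<^sub>M count_space UNIV"
    and "\<And>n' k l. n' \<le> n \<Longrightarrow> k \<ge> 1 \<Longrightarrow> l \<ge> 1 \<Longrightarrow> \<xi> n' k l \<in> M' \<rightarrow>\<^sub>M count_space UNIV"
  shows "inar_limit \<epsilon> \<xi> n \<in> M' \<rightarrow>\<^sub>M count_space UNIV"
proof -
  have "(\<lambda>\<omega>. lim (\<lambda>L. real (inar_trunc \<epsilon> \<xi> n L \<omega>))) \<in> borel_measurable M'"
    by (intro borel_measurable_lim_metric borel_measurable_real_nat inar_trunc_measurable assms)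
  then have "(\<lambda>\<omega>. \<lfloor>lim (\<lambda>L. real (inar_trunc \<epsilon> \<xi> n L \<omega>))\<rfloor>) \<in> M' \<rightarrow>\<^sub>M count_space UNIV"
    by (rule measurable_compose[OF _ measurable_real_floor])
  then have "(\<lambda>\<omega>. nat \<lfloor>lim (\<lambda>L. real (inar_trunc \<epsilon> \<xi> n L \<omega>))\<rfloor>) \<in> M' \<rightarrow>\<^sub>M count_space UNIV"
    by (rule measurable_compose[where g=nat]) simp
  then show ?thesis
    unfolding inar_limit_def[abs_def] .
qed

text \<open>A bounded increasing sequence of natural numbers attains its maximum and is constant
  from there on.\<close>

lemma eventually_eq_inar_limit:
  assumes "bdd_above (range (\<lambda>L. inar_trunc \<epsilon> \<xi> n L \<omega>))"
  shows "eventually (\<lambda>L. inar_trunc \<epsilon> \<xi> n L \<omega> = inar_limit \<epsilon> \<xi> n \<omega>) sequentially"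
proof -
  let ?u = "\<lambda>L. inar_trunc \<epsilon> \<xi> n L \<omega>"
  have "finite (range ?u)" using assms unfolding bdd_above_nat .
  then have "Max (range ?u) \<in> range ?u" by (intro Max_in) auto
  then obtain L0 where "Max (range ?u) = ?u L0" by (rule rangeE)
  then have L0: "?u L0 = Max (range ?u)" by (rule sym)
  have ev: "?u L = ?u L0" if "L \<ge> L0" for L
  proof (rule antisym)
    show "?u L \<le> ?u L0" unfolding L0 by (rule Max_ge[OF \<open>finite (range ?u)\<close> rangeI])
    show "?u L0 \<le> ?u L" using incseqD[OF incseq_inar_trunc that] .
  qed
  then have ev': "eventually (\<lambda>L. ?u L = ?u L0) sequentially"
    unfolding eventually_sequentially by blast
  then have "eventually (\<lambda>L. real (?u L) = real (?u L0)) sequentially"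
    by (rule eventually_mono) simp
  then have "(\<lambda>L. real (?u L)) \<longlonglongrightarrow> real (?u L0)"
    by (rule tendsto_eventually)
  from limI[OF this] have "inar_limit \<epsilon> \<xi> n \<omega> = ?u L0"
    unfolding inar_limit_def by (simp only: floor_of_nat nat_int)
  with ev' show ?thesis by (simp only:)
qed

lemma inar_trunc_le_limit:
  assumes "bdd_above (range (\<lambda>L. inar_trunc \<epsilon> \<xi> n L \<omega>))"
  shows "inar_trunc \<epsilon> \<xi> n L \<omega> \<le> inar_limit \<epsilon> \<xi> n \<omega>"
proof -
  from eventually_eq_inar_limit[OF assms] obtain L' where
    "\<And>N. N \<ge> L' \<Longrightarrow> inar_trunc \<epsilon> \<xi> n N \<omega> = inar_limit \<epsilon> \<xi> n \<omega>"
    unfolding eventually_sequentially by blast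
  then show ?thesis using incseqD[OF incseq_inar_trunc, of L "max L L'" \<epsilon> \<xi> n \<omega>] by simp
qed

text \<open>From left to right, one \<open>L\<close> that attains the limit suffices, with the
  parents' numbers enlarged to their limits. From right to left, finitely many lags reach their
  limits at one common \<open>L\<close>, which bounds every partial sum of the series.\<close>

lemma inar_limit_recursion:
  assumes bdd: "\<And>n. bdd_above (range (\<lambda>L. inar_trunc \<epsilon> \<xi> n L \<omega>))"
  defines "Y \<equiv> inar_limit \<epsilon> \<xi>"
  shows "of_nat (Y n \<omega>) = (of_nat (\<epsilon> n \<omega>) +
     (\<Sum>k. of_nat (\<Sum>l = 1..Y (n - int (Suc k)) \<omega>. \<xi> n (Suc k) l \<omega>)) :: ennreal)"
proof (rule antisym)
  let ?S = "\<lambda>k. \<Sum>l = 1..Y (n - int (Suc k)) \<omega>. \<xi> n (Suc k) l \<omega>"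
  let ?U = "inar_trunc \<epsilon> \<xi>"
  have U: "?U n L \<omega> = \<epsilon> n \<omega> + (\<Sum>k<L. \<Sum>l=1..?U (n - int (Suc k)) (L - Suc k) \<omega>. \<xi> n (Suc k) l \<omega>)" for L
    unfolding inar_trunc.simps[of \<epsilon> \<xi> n L]
    by (rule arg_cong[of _ _ "(+) _"], rule sum.reindex_bij_witness[of _ Suc "\<lambda>k. k - 1"]) auto
  have ev: "eventually (\<lambda>L. ?U n L \<omega> = Y n \<omega>) sequentially" for n
    unfolding Y_def by (rule eventually_eq_inar_limit[OF bdd])
  obtain L where L: "?U n L \<omega> = Y n \<omega>"
    using eventually_happens[OF ev[of n]] by auto
  have "?U n L \<omega> \<le> \<epsilon> n \<omega> + (\<Sum>k<L. ?S k)"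
    unfolding U by (intro add_left_mono sum_mono sum_mono2)
      (auto simp: Y_def intro: order_trans[OF _ inar_trunc_le_limit[OF bdd]])
  then have "(of_nat (Y n \<omega>) :: ennreal) \<le> of_nat (\<epsilon> n \<omega> + (\<Sum>k<L. ?S k))"
    unfolding L by (simp only: of_nat_le_iff)
  also have "\<dots> = of_nat (\<epsilon> n \<omega>) + (\<Sum>k<L. of_nat (?S k))"
    by (simp only: of_nat_add of_nat_sum)
  also have "\<dots> \<le> of_nat (\<epsilon> n \<omega>) + (\<Sum>k. of_nat (?S k))"
    by (intro add_left_mono sum_le_suminf summableI) auto
  finally show "of_nat (Y n \<omega>) \<le> (of_nat (\<epsilon> n \<omega>) + (\<Sum>k. of_nat (?S k)) :: ennreal)" .
  have part: "\<epsilon> n \<omega> + (\<Sum>k<K0. ?S k) \<le> Y n \<omega>" for K0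
  proof -
    have "eventually (\<lambda>L. \<forall>k\<in>{..<K0}. ?U (n - int (Suc k)) (L - Suc k) \<omega> = Y (n - int (Suc k)) \<omega>) sequentially"
    proof (rule eventually_ball_finite[OF finite_lessThan], rule ballI)
      fix k
      show "eventually (\<lambda>L. ?U (n - int (Suc k)) (L - Suc k) \<omega> = Y (n - int (Suc k)) \<omega>) sequentially"
        using ev[of "n - int (Suc k)"] by (rule eventually_compose_filterlim) (rule filterlim_minus_const_nat_at_top)
    qed
    with ev[of n] eventually_ge_at_top[of K0]
    have "eventually (\<lambda>L. ?U n L \<omega> = Y n \<omega> \<and> L \<ge> K0 \<and>
       (\<forall>k\<in>{..<K0}. ?U (n - int (Suc k)) (L - Suc k) \<omega> = Y (n - int (Suc k)) \<omega>)) sequentially"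
      by (intro eventually_conj)
    from eventually_happens'[OF sequentially_bot this]
    obtain L where L: "?U n L \<omega> = Y n \<omega>" "L \<ge> K0"
      "\<And>k. k < K0 \<Longrightarrow> ?U (n - int (Suc k)) (L - Suc k) \<omega> = Y (n - int (Suc k)) \<omega>"
      by blast
    have "(\<Sum>k<K0. ?S k) = (\<Sum>k<K0. \<Sum>l=1..?U (n - int (Suc k)) (L - Suc k) \<omega>. \<xi> n (Suc k) l \<omega>)"
      by (rule sum.cong[OF refl]) (simp only: lessThan_iff L(3))
    also have "\<dots> \<le> (\<Sum>k<L. \<Sum>l=1..?U (n - int (Suc k)) (L - Suc k) \<omega>. \<xi> n (Suc k) l \<omega>)"
      by (rule sum_mono2) (use L(2) in auto)
    finally show ?thesis using U[of L] L(1) by simp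
  qed
  \<comment> \<open>The subtraction is exact, since \<open>part\<close> at 0 gives
    \<open>\<epsilon> n \<omega> \<le> Y n \<omega>\<close>.\<close>
  have "(\<Sum>k. of_nat (?S k) :: ennreal) \<le> of_nat (Y n \<omega> - \<epsilon> n \<omega>)"
  proof (rule suminf_le_const[OF summableI])
    fix K0
    have "(\<Sum>k<K0. ?S k) \<le> Y n \<omega> - \<epsilon> n \<omega>" using part[of K0] by linarith
    then have "(of_nat (\<Sum>k<K0. ?S k) :: ennreal) \<le> of_nat (Y n \<omega> - \<epsilon> n \<omega>)"
      by (simp only: of_nat_le_iff)
    then show "(\<Sum>k<K0. of_nat (?S k) :: ennreal) \<le> of_nat (Y n \<omega> - \<epsilon> n \<omega>)"
      by (simp only: of_nat_sum)
  qed
  then have "of_nat (\<epsilon> n \<omega>) + (\<Sum>k. of_nat (?S k) :: ennreal) \<le> of_nat (\<epsilon> n \<omega>) + of_nat (Y n \<omega> - \<epsilon> n \<omega>)"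
    by (rule add_left_mono)
  also have "\<dots> = of_nat (Y n \<omega>)"
    using part[of 0] by (simp add: of_nat_add[symmetric] del: of_nat_add)
  finally show "of_nat (\<epsilon> n \<omega>) + (\<Sum>k. of_nat (?S k) :: ennreal) \<le> of_nat (Y n \<omega>)" .
qed

lemma (in prob_space) indep_rv_gen_sigma:
  assumes Z: "indep_vars (\<lambda>_. count_space UNIV) Z I"
    and AB: "A \<subseteq> I" "B \<subseteq> I" "A \<inter> B = {}"
    and f: "f \<in> gen_sigma M Z A \<rightarrow>\<^sub>M S" and h: "h \<in> gen_sigma M Z B \<rightarrow>\<^sub>M T"
  shows "indep_rv S f T h"
proof -
  have rv: "Z i \<in> M \<rightarrow>\<^sub>M count_space UNIV" if "i \<in> I" for i
    using Z that by (auto simp: indep_vars_def)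
  have "f \<in> M \<rightarrow>\<^sub>M S" "h \<in> M \<rightarrow>\<^sub>M T"
    by (rule measurable_gen_sigmaD[OF _ f] measurable_gen_sigmaD[OF _ h]; use rv AB in blast)+
  moreover have "{f -` E \<inter> space M |E. E \<in> sets S} \<subseteq> sets (gen_sigma M Z A)"
    using measurable_sets[OF f] by (simp add: subset_eq) blast
  moreover have "{h -` E \<inter> space M |E. E \<in> sets T} \<subseteq> sets (gen_sigma M Z B)"
    using measurable_sets[OF h] by (simp add: subset_eq) blast
  ultimately show ?thesis
    using indep_set_gen_sigma[OF Z AB] unfolding indep_rv_def indep_sets2_eq by blast
qed

context inar_noise
begin

abbreviation "Y \<equiv> inar_limit \<epsilon> \<xi>"

lemma Y_measurable: "Y n \<in> M \<rightarrow>\<^sub>M count_space UNIV"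
  by (rule inar_limit_measurable[OF \<epsilon>_measurable \<xi>_measurable])

text \<open>\<open>Y\<close> is one fixed measurable function \<Phi> of the whole noise. A shift in
  time only permutes noise indices among variables of equal law, so by independence the joint law
  \<open>D\<close> is unchanged, and with it the law of its image under \<Phi>.\<close>

lemma stationary_inar_limit: "strictly_stationary M Y"
proof -
  define C :: "nat measure" where "C = count_space UNIV"
  define Q where "Q i = distr M C (noise i)" for i
  define D where "D = (\<Pi>\<^sub>M i\<in>noise_index. Q i)"
  define sh :: "int \<Rightarrow> int + int \<times> nat \<times> nat \<Rightarrow> int + int \<times> nat \<times> nat"
    where "sh h = map_sum (\<lambda>n. n + h) (apfst (\<lambda>n. n + h))" for h
  \<comment> \<open>Coordinates on the product space in the roles of immigration and offspring; the
    limit formed from them is the canonical version of \<open>Y\<close>.\<close>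
  define E where "E n z = z (Inl n :: int + int \<times> nat \<times> nat)" for n and z :: "_ \<Rightarrow> nat"
  define X where "X n k l z = z (Inr (n, k, l) :: int + int \<times> nat \<times> nat)" for n k l and z :: "_ \<Rightarrow> nat"
  define \<Phi> where "\<Phi> z = (\<lambda>n. inar_limit E X n z)" for z
  have Q: "prob_space (Q i)" if "i \<in> noise_index" for i
    unfolding Q_def C_def by (rule prob_space_distr[OF noise_measurable[OF that]])
  have sets_Q: "sets (Q i) = sets C" "space (Q i) = space C" for i by (simp_all add: Q_def)
  have sets_D: "sets D = sets (\<Pi>\<^sub>M i\<in>noise_index. C)"
    unfolding D_def by (rule sets_PiM_cong) (simp_all add: sets_Q)
  have sh_in: "sh h i \<in> noise_index" if "i \<in> noise_index" for h i
    using that by (auto simp: sh_def)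
  have inj: "inj_on (sh h) noise_index" for h
    unfolding sh_def by (rule inj_onI) (auto simp: map_sum_def split: sum.splits)
  have Q_sh: "Q (sh h i) = Q i" if "i \<in> noise_index" for h i
    using that by (auto simp: Q_def sh_def C_def distr_\<epsilon> distr_\<xi>)
  have D: "distr M (\<Pi>\<^sub>M i\<in>noise_index. C) (\<lambda>\<omega>. \<lambda>i\<in>noise_index. noise i \<omega>) = D"
    unfolding D_def Q_def C_def
    using indep_noise' 
      indep_vars_iff_distr_eq_PiM'[where I=noise_index and M'="\<lambda>_. count_space UNIV" and X=noise] noise_measurable
    by blast
  have meas_sh: "(\<lambda>\<omega>. \<lambda>i\<in>noise_index. noise (sh h i) \<omega>) \<in> M \<rightarrow>\<^sub>M (\<Pi>\<^sub>M i\<in>noise_index. C)" for h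
    unfolding C_def by (intro measurable_restrict noise_measurable sh_in)
  have D_sh: "distr M (\<Pi>\<^sub>M i\<in>noise_index. C) (\<lambda>\<omega>. \<lambda>i\<in>noise_index. noise (sh h i) \<omega>) = D" for h
  proof -
    let ?t = "\<lambda>z. \<lambda>i\<in>noise_index. z (sh h i)"
    have "?t \<in> (\<Pi>\<^sub>M i\<in>noise_index. C) \<rightarrow>\<^sub>M (\<Pi>\<^sub>M i\<in>noise_index. C)"
      by (intro measurable_restrict measurable_component_singleton sh_in)
    moreover have "(\<lambda>\<omega>. \<lambda>i\<in>noise_index. noise i \<omega>) \<in> M \<rightarrow>\<^sub>M (\<Pi>\<^sub>M i\<in>noise_index. C)"
      unfolding C_def by (intro measurable_restrict noise_measurable)
    ultimately have "distr D (\<Pi>\<^sub>M i\<in>noise_index. C) ?t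
        = distr M (\<Pi>\<^sub>M i\<in>noise_index. C) (?t \<circ> (\<lambda>\<omega>. \<lambda>i\<in>noise_index. noise i \<omega>))"
      unfolding D[symmetric] by (rule distr_distr)
    also have "?t \<circ> (\<lambda>\<omega>. \<lambda>i\<in>noise_index. noise i \<omega>) = (\<lambda>\<omega>. \<lambda>i\<in>noise_index. noise (sh h i) \<omega>)"
      by (rule ext, unfold comp_def, rule restrict_ext, rule restrict_apply', rule sh_in)
    finally have "distr M (\<Pi>\<^sub>M i\<in>noise_index. C) (\<lambda>\<omega>. \<lambda>i\<in>noise_index. noise (sh h i) \<omega>)
        = distr D (\<Pi>\<^sub>M i\<in>noise_index. C) ?t" by (rule sym)
    \<comment> \<open>Only the \<sigma>-algebra of the target matters here; it is rewritten into the
      form in which product measures can be reindexed.\<close>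
    also have "\<dots> = distr D (\<Pi>\<^sub>M i\<in>noise_index. Q (sh h i)) ?t"
      by (rule distr_cong[OF refl]) (simp_all add: sets_Q cong: sets_PiM_cong)
    also have "\<dots> = (\<Pi>\<^sub>M i\<in>noise_index. Q (sh h i))"
      unfolding D_def by (rule distr_PiM_reindex[OF Q inj Pi_I]) (simp_all only: sh_in)
    also have "\<dots> = D"
      unfolding D_def by (rule PiM_cong[OF refl Q_sh])
    finally show ?thesis .
  qed
  have coord: "(\<lambda>z. z i) \<in> (\<Pi>\<^sub>M i\<in>noise_index. C) \<rightarrow>\<^sub>M count_space UNIV" if "i \<in> noise_index" for i
    unfolding C_def by (rule measurable_component_singleton[OF that])
  have \<Phi>_meas: "\<Phi> \<in> (\<Pi>\<^sub>M i\<in>noise_index. C) \<rightarrow>\<^sub>M (\<Pi>\<^sub>M n\<in>UNIV. C)"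
    unfolding \<Phi>_def
  proof (rule measurable_PiM_single')
    show "inar_limit E X n \<in> (\<Pi>\<^sub>M i\<in>noise_index. C) \<rightarrow>\<^sub>M C" for n
      unfolding C_def
    proof (rule inar_limit_measurable)
      show "E n' \<in> Pi\<^sub>M noise_index (\<lambda>_. count_space UNIV) \<rightarrow>\<^sub>M count_space UNIV" for n'
        using coord[OF InlI[OF UNIV_I], of n'] unfolding E_def[abs_def] C_def by simp
      show "X n' k l \<in> Pi\<^sub>M noise_index (\<lambda>_. count_space UNIV) \<rightarrow>\<^sub>M count_space UNIV"
        if "k \<ge> 1" "l \<ge> 1" for n' k l
      proof -
        have "Inr (n', k, l) \<in> noise_index" using that by auto
        from coord[OF this] show ?thesis unfolding X_def[abs_def] C_def .
      qed
    qed
  qed (simp add: C_def)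
  have Y_\<Phi>: "(\<lambda>n. Y (n + h) \<omega>) = \<Phi> (\<lambda>i\<in>noise_index. noise (sh h i) \<omega>)" for h \<omega>
  proof (rule ext)
    fix n
    have "U (n + h) L \<omega> = inar_trunc E X n L (\<lambda>i\<in>noise_index. noise (sh h i) \<omega>)" for L
      by (rule inar_trunc_shift) (auto simp: E_def X_def sh_def)
    then show "Y (n + h) \<omega> = \<Phi> (\<lambda>i\<in>noise_index. noise (sh h i) \<omega>) n"
      unfolding \<Phi>_def inar_limit_def by simp
  qed
  have law: "distr M (\<Pi>\<^sub>M n\<in>UNIV. C) (\<lambda>\<omega> n. Y (n + h) \<omega>) = distr D (\<Pi>\<^sub>M n\<in>UNIV. C) \<Phi>" for h
  proof -
    have "(\<lambda>\<omega> n. Y (n + h) \<omega>) = \<Phi> \<circ> (\<lambda>\<omega>. \<lambda>i\<in>noise_index. noise (sh h i) \<omega>)"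
      by (rule ext) (simp only: comp_def Y_\<Phi>)
    then show ?thesis
      by (simp only: distr_distr[OF \<Phi>_meas meas_sh, symmetric] D_sh)
  qed
  show ?thesis
    unfolding strictly_stationary_def
    using law[unfolded C_def] law[of 0, unfolded C_def add_0_right] by simp
qed

text \<open>The noise at time \<open>n\<close> and the noise before \<open>n\<close> are disjoint
  blocks, and earlier values of \<open>Y\<close> are functions of the second block.\<close>

lemma indep_inar_limit:
  "indep_rv
     (count_space UNIV \<Otimes>\<^sub>M (\<Pi>\<^sub>M p\<in>{1..} \<times> {1..}. count_space UNIV))
     (\<lambda>\<omega>. (\<epsilon> n \<omega>, \<lambda>p\<in>{1..} \<times> {1..}. \<xi> n (fst p) (snd p) \<omega>))
     (\<Pi>\<^sub>M j\<in>{..<n}. count_space UNIV)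
     (\<lambda>\<omega>. \<lambda>j\<in>{..<n}. Y j \<omega>)"
proof -
  define A where "A = {x \<in> noise_index. noise_time x = n}"
  define B where "B = {x \<in> noise_index. noise_time x < n}"
  have A: "noise x \<in> gen_sigma M noise A \<rightarrow>\<^sub>M count_space UNIV" if "x \<in> A" for x
    by (rule measurable_gen_sigma[OF that])
  have B: "noise x \<in> gen_sigma M noise B \<rightarrow>\<^sub>M count_space UNIV" if "x \<in> B" for x
    by (rule measurable_gen_sigma[OF that])
  show ?thesis
  proof (rule indep_rv_gen_sigma[OF indep_noise', of A B])
    show "A \<subseteq> noise_index" "B \<subseteq> noise_index" "A \<inter> B = {}" by (auto simp: A_def B_def)
    have "\<epsilon> n \<in> gen_sigma M noise A \<rightarrow>\<^sub>M count_space UNIV"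
      using A[of "Inl n"] by (auto simp: A_def)
    moreover have "\<xi> n (fst p) (snd p) \<in> gen_sigma M noise A \<rightarrow>\<^sub>M count_space UNIV"
      if "p \<in> {1..} \<times> {1..}" for p
    proof -
      have "Inr (n, fst p, snd p) \<in> A" using that by (auto simp: A_def)
      from A[OF this] show ?thesis by (simp add: case_prod_unfold)
    qed
    ultimately show "(\<lambda>\<omega>. (\<epsilon> n \<omega>, \<lambda>p\<in>{1..} \<times> {1..}. \<xi> n (fst p) (snd p) \<omega>))
        \<in> gen_sigma M noise A \<rightarrow>\<^sub>M count_space UNIV \<Otimes>\<^sub>M (\<Pi>\<^sub>M p\<in>{1..} \<times> {1..}. count_space UNIV)"
      by (intro measurable_Pair measurable_restrict)
    have "Y j \<in> gen_sigma M noise B \<rightarrow>\<^sub>M count_space UNIV" if "j < n" for j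
    proof (rule inar_limit_measurable)
      fix n' assume "n' \<le> j"
      then show "\<epsilon> n' \<in> gen_sigma M noise B \<rightarrow>\<^sub>M count_space UNIV"
        using B[of "Inl n'"] that by (auto simp: B_def)
    next
      fix n' and k l :: nat assume "n' \<le> j" "k \<ge> 1" "l \<ge> 1"
      then show "\<xi> n' k l \<in> gen_sigma M noise B \<rightarrow>\<^sub>M count_space UNIV"
        using B[of "Inr (n', k, l)"] that by (auto simp: B_def)
    qed
    then show "(\<lambda>\<omega>. \<lambda>j\<in>{..<n}. Y j \<omega>) \<in> gen_sigma M noise B \<rightarrow>\<^sub>M (\<Pi>\<^sub>M j\<in>{..<n}. count_space UNIV)"
      by (intro measurable_restrict) simp
  qed
qed

section \<open>Subcritical reproduction: bounds uniform in the starting time\<close>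

context
  fixes K :: real
  assumes \<alpha>: "\<And>k. \<alpha> k \<ge> 0" and K: "(\<lambda>k. \<alpha> (Suc k)) sums K" "K < 1"
begin

lemma K_nonneg: "0 \<le> K"
  using sums_le[of "\<lambda>_. 0" "\<lambda>k. \<alpha> (Suc k)" 0 K] \<alpha> K by simp

lemma sum_\<alpha>_le: "(\<Sum>k=1..n. \<alpha> k) \<le> K"
proof -
  have "(\<Sum>k=1..n. \<alpha> k) = (\<Sum>k<n. \<alpha> (Suc k))"
    by (rule sum.reindex_bij_witness[of _ Suc "\<lambda>k. k - 1"]) auto
  also have "\<dots> \<le> (\<Sum>k. \<alpha> (Suc k))"
    by (rule sum_le_suminf) (use \<alpha> K in \<open>auto simp: sums_iff\<close>)
  finally show ?thesis using K by (simp add: sums_iff)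
qed

text \<open>The radius is chosen so that each nonzero \<open>t j\<close> contributes at most 1 to
  the bound in \<open>sum_pos_cumulant_le\<close>.\<close>

lemma sum_pos_le_card:
  assumes "\<And>j. t j \<le> ((1 - K) / 2)\<^sup>2"
    and "\<And>j. j \<le> m \<Longrightarrow> c j = t j + (\<Sum>k=1..m-j. \<alpha> k * (exp (c (j + k)) - 1))"
  shows "(\<Sum>j\<le>m. max 0 (exp (c j) - 1)) \<le> real (card {j. j \<le> m \<and> t j \<noteq> 0})"
proof -
  let ?b = "(1 - K) / 2"
  note r = radius_bounds[OF K_nonneg K(2)]
  have "(\<Sum>j\<le>m. max 0 (exp (c j) - 1))
      \<le> real (card {j. j \<le> m \<and> t j \<noteq> 0}) * (exp (?b\<^sup>2) - 1) / (1 - (1 + ?b) * K)"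
    by (rule sum_pos_cumulant_le[OF \<alpha> sum_\<alpha>_le _ _ r(3) assms r(4)]) (use r(1) in auto)
  also have "\<dots> = real (card {j. j \<le> m \<and> t j \<noteq> 0}) * ((exp (?b\<^sup>2) - 1) / (1 - (1 + ?b) * K))"
    by (rule times_divide_eq_right[symmetric])
  also have "\<dots> \<le> real (card {j. j \<le> m \<and> t j \<noteq> 0})"
    by (rule mult_left_le[OF r(5)]) simp
  finally show ?thesis .
qed

lemma sum_abs_le_card:
  assumes "\<And>j. t j \<le> ((1 - K) / 2)\<^sup>2"
    and "\<And>j. j \<le> m \<Longrightarrow> c j = t j + (\<Sum>k=1..m-j. \<alpha> k * (exp (c (j + k)) - 1))"
  shows "(\<Sum>j\<le>m. \<bar>exp (c j) - 1\<bar>)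
    \<le> real (card {j. j \<le> m \<and> t j \<noteq> 0}) / (1 - (1 + (1 - K) / 2) * K)"
proof -
  note r = radius_bounds[OF K_nonneg K(2)]
  show ?thesis
    by (rule sum_abs_cumulant_le[OF \<alpha> sum_\<alpha>_le _ _ r(3) assms r(4,2)]) (use r(1) in auto)
qed

text \<open>Counting the nonzero exponents instead of all \<open>Suc m\<close> times keeps the bound
  stable when the starting time recedes.\<close>

lemma nn_integral_inar_trunc_le:
  assumes "\<And>j. t j \<le> ((1 - K) / 2)\<^sup>2"
  shows "(\<integral>\<^sup>+\<omega>. ennreal (exp (\<Sum>j\<le>m. t j * real (U (s + int j) j \<omega>))) \<partial>M)
     \<le> ennreal (exp (\<alpha> 0 * real (card {j. j \<le> m \<and> t j \<noteq> 0})))"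
proof -
  define c where "c j = cgf \<alpha> (m - j) (\<lambda>n. t (n + j))" for j
  have c: "c j = t j + (\<Sum>k=1..m-j. \<alpha> k * (exp (c (j + k)) - 1))" for j
    unfolding c_def by (rule cgf_shift)
  have "(\<Sum>j\<le>m. exp (c j) - 1) \<le> (\<Sum>j\<le>m. max 0 (exp (c j) - 1))"
    by (intro sum_mono) simp
  also have "\<dots> \<le> real (card {j. j \<le> m \<and> t j \<noteq> 0})"
    by (rule sum_pos_le_card[OF assms c])
  finally have "exp (\<alpha> 0 * (\<Sum>j\<le>m. exp (c j) - 1)) \<le> exp (\<alpha> 0 * real (card {j. j \<le> m \<and> t j \<noteq> 0}))"
    using \<alpha>[of 0] by (simp add: mult_left_mono)
  then show ?thesis
    unfolding nn_integral_inar_trunc[OF \<alpha> c] by (rule ennreal_leI)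
qed

text \<open>One value has an exponential moment bounded uniformly in the depth. By monotone
  convergence the supremum of the exponentials is integrable, hence almost surely finite, and it
  bounds the truncations.\<close>

lemma AE_bdd_above_inar_trunc: "AE \<omega> in M. \<forall>n. bdd_above (range (\<lambda>L. U n L \<omega>))"
  unfolding AE_all_countable
proof
  fix n
  define \<delta> where "\<delta> = ((1 - K) / 2)\<^sup>2"
  have \<delta>: "\<delta> > 0" using K(2) by (simp add: \<delta>_def)
  define f where "f m \<omega> = ennreal (exp (\<delta> * real (U n m \<omega>)))" for m \<omega>
  have f_meas: "f m \<in> borel_measurable M" for m
  proof -
    have "(\<lambda>\<omega>. real (U n m \<omega>)) \<in> borel_measurable M"
      by (rule borel_measurable_real_nat[OF U_measurable])
    then show ?thesis unfolding f_def[abs_def] by measurable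
  qed
  have f_le: "(\<integral>\<^sup>+\<omega>. f m \<omega> \<partial>M) \<le> ennreal (exp (\<alpha> 0))" for m
  proof -
    \<comment> \<open>A single nonzero exponent at the last time, with starting time
      \<open>n - int m\<close>, so that the count in the bound is 1.\<close>
    define t where "t j = (if j = m then \<delta> else 0)" for j
    have "(\<Sum>j\<le>m. t j * real (U (n - int m + int j) j \<omega>)) = \<delta> * real (U n m \<omega>)" for \<omega>
      by (simp add: t_def if_distrib[of "\<lambda>x. x * _"] sum.delta cong: if_cong)
    moreover have "{j. j \<le> m \<and> t j \<noteq> 0} = {m}" using \<delta> by (auto simp: t_def)
    ultimately show ?thesis
      using nn_integral_inar_trunc_le[of t "n - int m" m] \<delta> by (simp add: t_def f_def \<delta>_def)
  qed
  have "incseq f"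
    unfolding incseq_def le_fun_def f_def using incseqD[OF incseq_inar_trunc] \<delta>
    by (auto intro!: ennreal_leI)
  then have "(\<integral>\<^sup>+\<omega>. (SUP m. f m \<omega>) \<partial>M) = (SUP m. \<integral>\<^sup>+\<omega>. f m \<omega> \<partial>M)"
    by (intro nn_integral_monotone_convergence_SUP f_meas)
  also have "\<dots> \<le> ennreal (exp (\<alpha> 0))" by (intro SUP_least f_le)
  finally have fin: "(\<integral>\<^sup>+\<omega>. (SUP m. f m \<omega>) \<partial>M) \<noteq> \<infinity>"
    using ennreal_less_top le_less_trans by (metis infinity_ennreal_def less_irrefl)
  have "AE \<omega> in M. (SUP m. f m \<omega>) \<noteq> \<infinity>"
    by (rule nn_integral_PInf_AE[OF _ fin]) (intro borel_measurable_SUP f_meas; simp)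
  then show "AE \<omega> in M. bdd_above (range (\<lambda>L. U n L \<omega>))"
  proof (eventually_elim)
    case (elim \<omega>)
    define S where "S = enn2real (SUP m. f m \<omega>)"
    have S: "(SUP m. f m \<omega>) = ennreal S"
      unfolding S_def using elim
      by (intro ennreal_enn2real[symmetric]) (simp only: less_top[symmetric] infinity_ennreal_def not_False_eq_True)
    have "U n m \<omega> \<le> nat \<lceil>S / \<delta>\<rceil>" for m
    proof -
      have "ennreal (exp (\<delta> * real (U n m \<omega>))) \<le> ennreal S"
        unfolding S[symmetric] f_def[symmetric] by (rule SUP_upper) simp
      then have "exp (\<delta> * real (U n m \<omega>)) \<le> S"
        by (subst (asm) ennreal_le_iff) (simp_all add: S_def)
      then have "\<delta> * real (U n m \<omega>) \<le> S"
        using exp_ge_add_one_self[of "\<delta> * real (U n m \<omega>)"] by linarith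
      then have "real (U n m \<omega>) \<le> S / \<delta>" using \<delta> by (simp add: field_simps)
      then show ?thesis by linarith
    qed
    then show ?case by (intro bdd_aboveI2)
  qed
qed

lemma inar_solution_inar_limit: "inar_solution Y"
  unfolding inar_solution_def
proof (intro conjI allI Y_measurable stationary_inar_limit indep_inar_limit)
  show "AE \<omega> in M. \<forall>n. of_nat (Y n \<omega>) = (of_nat (\<epsilon> n \<omega>) +
         (\<Sum>k. of_nat (\<Sum>l = 1..Y (n - int (Suc k)) \<omega>. \<xi> n (Suc k) l \<omega>)) :: ennreal)"
    using AE_bdd_above_inar_trunc
  proof eventually_elim
    case (elim \<omega>)
    show ?case by (rule allI, rule inar_limit_recursion, rule spec[OF elim])
  qed
qed

end

end

section \<open>Moment-generating functions\<close>

lemma seq_supp_cases: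
  obtains "\<And>D. \<not> (\<forall>n>D. t n = 0)" "seq_supp t = \<infinity>"
  | D where "seq_supp t = enat D" "\<And>n. n > D \<Longrightarrow> t n = 0"
proof (cases "{n. \<forall>k>n. t k = 0} = {}")
  case True
  then have "seq_supp t = \<infinity>"
    unfolding seq_supp_def by (simp only: image_empty Inf_enat_def simp_thms if_True)
  with True show ?thesis by (intro that(1)) blast+
next
  case False
  let ?S = "enat ` {n. \<forall>k>n. t k = 0}"
  have "seq_supp t = (LEAST x. x \<in> ?S)"
    unfolding seq_supp_def Inf_enat_def using False by (simp only: image_is_empty if_False)
  moreover have "(LEAST x. x \<in> ?S) \<in> ?S"
    by (rule LeastI_ex) (use False in blast)
  ultimately obtain D where "seq_supp t = enat D" "\<forall>k>D. t k = 0"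
    by auto
  then show ?thesis using that(2) by blast
qed

lemma c00_iff: "t \<in> c00 A \<longleftrightarrow> range t \<subseteq> A \<and> (\<exists>D. \<forall>n>D. t n = 0)"
  by (rule seq_supp_cases[of t]) (auto simp: c00_def)

lemma c00_shift: "t \<in> c00 A \<Longrightarrow> (\<lambda>n. t (n + k)) \<in> c00 A"
  unfolding c00_iff by (auto intro: trans_less_add1)

lemma c00_eq_0: "t \<in> c00 A \<Longrightarrow> n > the_enat (seq_supp t) \<Longrightarrow> t n = 0"
  by (rule seq_supp_cases[of t]) (auto simp: c00_def)

text \<open>The right-hand side involves only shifts by at least 1, which shorten the support, so
  induction on its length determines the function from its value at zero. That value must be
  prescribed: at the zero sequence the equation reads \<open>x = exp (K * (x - 1))\<close>, which
  for \<open>0 < K < 1\<close> has a second root above 1.\<close>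

lemma family_equation_unique:
  assumes \<phi>: "solves_family_equation \<alpha> \<delta> \<phi>" and \<psi>: "solves_family_equation \<alpha> \<delta> \<psi>"
    and eq0: "\<phi> (\<lambda>_. 0) = \<psi> (\<lambda>_. 0)" and s: "s \<in> c00 {..\<delta>}"
  shows "\<phi> s = \<psi> s"
proof -
  have *: "\<phi> s = \<psi> s" if "s \<in> c00 {..\<delta>}" "\<And>n. n \<ge> D \<Longrightarrow> s n = 0" for s D
    using that
  proof (induction D arbitrary: s)
    case 0
    then have "s = (\<lambda>_. 0)" by auto
    with eq0 show ?case by simp
  next
    case (Suc D)
    have IH: "\<phi> (\<lambda>n. s (n + Suc k)) = \<psi> (\<lambda>n. s (n + Suc k))" for k
      by (rule Suc.IH[OF c00_shift[OF Suc.prems(1)]]) (use Suc.prems(2) in simp)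
    have eq: "f s = exp (s 0) * exp (\<Sum>k. \<alpha> (Suc k) * (f (\<lambda>n. s (n + Suc k)) - 1))"
      if "solves_family_equation \<alpha> \<delta> f" for f
      using that Suc.prems(1) unfolding solves_family_equation_def by blast
    show ?case
      unfolding eq[OF \<phi>] eq[OF \<psi>] IH ..
  qed
  obtain D where "\<forall>n>D. s n = 0" using s unfolding c00_iff by blast
  then show ?thesis by (intro *[of _ "Suc D"] s) auto
qed

lemma cgf_zero: "cgf \<alpha> 0 (\<lambda>_. 0) = 0"
  by (subst cgf.simps) simp

context family_noise
begin

lemma joint_mgf_family_cgf:
  assumes "\<And>k. \<alpha> k \<ge> 0" and s: "\<And>n. n > m \<Longrightarrow> s n = 0"
  shows "joint_mgf N (family \<zeta>) s = ennreal (exp (cgf \<alpha> m s))"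
proof -
  define c where "c j = cgf \<alpha> (m - j) (\<lambda>n. s (n + j))" for j
  have "c j = s j + (\<Sum>k=1..m-j. \<alpha> k * (exp (c (j + k)) - 1))" for j
    unfolding c_def by (rule cgf_shift)
  then have "joint_mgf N (family \<zeta>) s = ennreal (exp (c 0))"
    by (rule joint_mgf_family[OF assms(1) _ s])
  moreover have "c 0 = cgf \<alpha> m s" by (simp add: c_def)
  ultimately show ?thesis by (simp only:)
qed

definition mgf :: "(nat \<Rightarrow> real) \<Rightarrow> real" where
  "mgf s = enn2real (joint_mgf N (family \<zeta>) s)"

lemma mgf_eq:
  assumes "\<And>k. \<alpha> k \<ge> 0" and "\<And>n. n > m \<Longrightarrow> s n = 0"
  shows "mgf s = exp (cgf \<alpha> m s)"
  unfolding mgf_def by (subst joint_mgf_family_cgf[where m=m, OF assms]) simp_all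

lemma mgf_zero:
  assumes "\<And>k. \<alpha> k \<ge> 0"
  shows "mgf (\<lambda>_. 0) = 1"
  by (subst mgf_eq[OF assms, of 0]) (simp_all add: cgf_zero)

text \<open>The recursion for \<open>cgf\<close>, exponentiated. The series has finitely many
  nonzero terms, because a shift beyond the support yields the zero sequence, where the function is
  1.\<close>

lemma mgf_solves:
  assumes \<alpha>: "\<And>k. \<alpha> k \<ge> 0"
  shows "solves_family_equation \<alpha> \<delta> mgf"
  unfolding solves_family_equation_def
proof (rule ballI)
  fix s assume "s \<in> c00 {..\<delta>}"
  then obtain D where D: "\<And>n. n > D \<Longrightarrow> s n = 0" unfolding c00_iff by blast
  let ?f = "\<lambda>k. \<alpha> (Suc k) * (mgf (\<lambda>n. s (n + Suc k)) - 1)"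
  have 0: "?f k = 0" if "k \<notin> {..<D}" for k
  proof -
    have "(\<lambda>n. s (n + Suc k)) = (\<lambda>_. 0)" using D that by auto
    then show ?thesis by (simp only: mgf_zero[OF \<alpha>]) simp
  qed
  have "mgf (\<lambda>n. s (n + k)) = exp (cgf \<alpha> (D - k) (\<lambda>n. s (n + k)))" for k
    by (rule mgf_eq[OF \<alpha>]) (use D in simp)
  then have "mgf s = exp (s 0 + (\<Sum>k=1..D. \<alpha> k * (mgf (\<lambda>n. s (n + k)) - 1)))"
    using mgf_eq[OF \<alpha>, of D s] D by (simp add: cgf.simps[of \<alpha> D s])
  also have "(\<Sum>k=1..D. \<alpha> k * (mgf (\<lambda>n. s (n + k)) - 1)) = (\<Sum>k<D. ?f k)"
    by (rule sum.reindex_bij_witness[of _ Suc "\<lambda>k. k - 1"]) auto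
  also have "\<dots> = (\<Sum>k. ?f k)"
    by (rule suminf_finite[symmetric]) (use 0 in auto)
  finally have "mgf s = exp (s 0) * exp (\<Sum>k. ?f k)" by (simp only: exp_add)
  moreover have "summable ?f" by (rule summable_finite[of "{..<D}"]) (use 0 in auto)
  ultimately show "summable ?f \<and> mgf s = exp (s 0) * exp (\<Sum>k. ?f k)" by simp
qed

end

section \<open>Passage to the limit in the starting time\<close>

lemma shift_seq_add: "shift_seq (int j - int L) t = (\<lambda>n. shift_seq (- int L) t (n + j))"
  by (rule ext) (simp add: shift_seq_def algebra_simps)

lemma sum_shift_int:
  fixes f :: "int \<Rightarrow> 'c::comm_monoid_add"
  shows "(\<Sum>j\<le>L+D. f (int j - int L)) = (\<Sum>i\<in>{- int L..int D}. f i)"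
  by (rule sum.reindex_bij_witness[of _ "\<lambda>i. nat (i + int L)" "\<lambda>j. int j - int L"]) auto

text \<open>A finite set of integers lies in some window except for places above \<open>D\<close>,
  where \<open>a\<close> vanishes; this gives absolute summability. Enumerating downwards from
  \<open>D\<close> by \<open>h\<close> then turns the infinite sum into the limit over the
  windows.\<close>

lemma summable_on_int_if_bounded_sums:
  fixes a :: "int \<Rightarrow> real"
  assumes 0: "\<And>i. i > int D \<Longrightarrow> a i = 0"
    and B: "\<And>L. (\<Sum>i\<in>{- int L..int D}. \<bar>a i\<bar>) \<le> B"
  shows "a summable_on UNIV" "(\<lambda>L. \<Sum>i\<in>{- int L..int D}. a i) \<longlonglongrightarrow> (\<Sum>\<^sub>\<infinity>i. a i)"
proof -
  have "(\<lambda>i. norm (a i)) summable_on UNIV"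
  proof (rule nonneg_bdd_above_summable_on)
    show "bdd_above (sum (\<lambda>i. norm (a i)) ` {F. F \<subseteq> UNIV \<and> finite F})"
    proof (rule bdd_aboveI2)
      fix F :: "int set" assume "F \<in> {F. F \<subseteq> UNIV \<and> finite F}"
      then have F: "finite F" by simp
      define L where "L = (\<Sum>i\<in>F. nat \<bar>i\<bar>)"
      have L: "- int L \<le> i" if "i \<in> F" for i
      proof -
        have "nat \<bar>i\<bar> \<le> L" unfolding L_def by (rule member_le_sum) (use that F in auto)
        then show ?thesis by linarith
      qed
      have "i \<le> int D" if "a i \<noteq> 0" for i using 0[of i] that by force
      then have "(\<Sum>i\<in>F. norm (a i)) = (\<Sum>i\<in>F \<inter> {..int D}. norm (a i))"
        by (intro sum.mono_neutral_right) (use F in auto)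
      also have "\<dots> \<le> (\<Sum>i\<in>{- int L..int D}. norm (a i))"
        by (rule sum_mono2) (use L in auto)
      also have "\<dots> \<le> B" using B[of L] by simp
      finally show "(\<Sum>i\<in>F. norm (a i)) \<le> B" .
    qed
  qed simp
  then show sm: "a summable_on UNIV" by (rule abs_summable_summable)
  define h where "h n = int D - int n" for n
  have "(a has_sum (\<Sum>\<^sub>\<infinity>i. a i)) UNIV" using sm by (rule has_sum_infsum)
  then have "(a has_sum (\<Sum>\<^sub>\<infinity>i. a i)) (range h)"
  proof (rule has_sum_cong_neutral[THEN iffD1, rotated -1])
    fix i assume i: "i \<in> UNIV - range h"
    have "i > int D"
    proof (rule ccontr)
      assume "\<not> i > int D"
      then have "i = h (nat (int D - i))" by (simp add: h_def)
      with i show False by blast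
    qed
    then show "a i = 0" by (rule 0)
  qed auto
  moreover have "inj h" by (rule injI) (simp add: h_def)
  ultimately have "((a \<circ> h) has_sum (\<Sum>\<^sub>\<infinity>i. a i)) UNIV"
    by (simp add: has_sum_reindex)
  then have "(\<lambda>n. a (h n)) sums (\<Sum>\<^sub>\<infinity>i. a i)"
    by (simp add: has_sum_imp_sums comp_def)
  then have "(\<lambda>L. \<Sum>n<L + Suc D. a (h n)) \<longlonglongrightarrow> (\<Sum>\<^sub>\<infinity>i. a i)"
    unfolding sums_def by (rule LIMSEQ_ignore_initial_segment)
  moreover have "(\<Sum>n<L + Suc D. a (h n)) = (\<Sum>i\<in>{- int L..int D}. a i)" for L
    by (rule sum.reindex_bij_witness[of _ "\<lambda>i. nat (int D - i)" h]) (auto simp: h_def)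
  ultimately show "(\<lambda>L. \<Sum>i\<in>{- int L..int D}. a i) \<longlonglongrightarrow> (\<Sum>\<^sub>\<infinity>i. a i)" by simp
qed

context inar_noise
begin

text \<open>Here \<phi> stands for the moment-generating function of the family process. It is
  described through \<open>cgf\<close> alone, so that a single probability space is
  involved.\<close>

lemma joint_mgf_inar_limit:
  fixes K D t \<phi>
  assumes \<alpha>: "\<And>k. \<alpha> k \<ge> 0" and K: "(\<lambda>k. \<alpha> (Suc k)) sums K" "K < 1"
    and t: "\<And>n. t n \<le> ((1 - K) / 2)\<^sup>2" and D: "\<And>n. n > D \<Longrightarrow> t n = 0"
    and \<phi>: "\<And>s m. (\<And>n. n > m \<Longrightarrow> s n = 0) \<Longrightarrow> \<phi> s = exp (cgf \<alpha> m s)"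
  defines "a \<equiv> \<lambda>i. \<phi> (shift_seq i t) - 1"
  shows "a summable_on UNIV"
    and "joint_mgf M Y t = ennreal (exp (\<alpha> 0 * (\<Sum>\<^sub>\<infinity>i. a i)))"
    and "joint_mgf M Y t \<le> ennreal (exp (\<alpha> 0 * (real D + 1)))"
proof -
  \<comment> \<open>For the process started at \<open>- int L\<close>, the exponents
    \<open>t\<close> sit at the positions from \<open>L\<close> to \<open>L + D\<close>.\<close>
  define T where "T L = shift_seq (- int L) t" for L
  define c where "c L j = cgf \<alpha> (L + D - j) (\<lambda>n. T L (n + j))" for L j
  have c: "c L j = T L j + (\<Sum>k=1..L+D-j. \<alpha> k * (exp (c L (j + k)) - 1))" for L j
    unfolding c_def by (rule cgf_shift)
  have T0: "T L n = 0" if "n < L \<or> n > L + D" for L n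
    using that D by (auto simp: T_def shift_seq_def)
  have T\<delta>: "T L n \<le> ((1 - K) / 2)\<^sup>2" for L n
    using t by (simp add: T_def shift_seq_def)
  have card: "card {j. j \<le> L + D \<and> T L j \<noteq> 0} \<le> Suc D" for L
  proof -
    have "L \<le> j" if "T L j \<noteq> 0" for j using T0[of j L] that by force
    then have "{j. j \<le> L + D \<and> T L j \<noteq> 0} \<subseteq> {L..L+D}" by auto
    from card_mono[OF _ this] show ?thesis by simp
  qed
  have a_c: "a (int j - int L) = exp (c L j) - 1" for L j
  proof -
    have "\<phi> (\<lambda>n. T L (n + j)) = exp (c L j)"
      unfolding c_def by (rule \<phi>, rule T0) arith
    then show ?thesis
      by (simp add: a_def shift_seq_add T_def)
  qed
  have a0: "a i = 0" if "i > int D" for i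
  proof -
    have "shift_seq i t = (\<lambda>_. 0)" by (rule ext) (use that D in \<open>simp add: shift_seq_def\<close>)
    moreover have "\<phi> (\<lambda>_. 0) = 1" by (subst \<phi>[of 0]) (simp_all add: cgf_zero)
    ultimately show ?thesis by (simp add: a_def)
  qed
  have den: "1 - (1 + (1 - K) / 2) * K > 0"
    using radius_bounds(4)[OF K_nonneg[OF \<alpha> K] K(2)] by simp
  have "(\<Sum>i\<in>{- int L..int D}. \<bar>a i\<bar>) \<le> (real D + 1) / (1 - (1 + (1 - K) / 2) * K)" for L
  proof -
    have "(\<Sum>i\<in>{- int L..int D}. \<bar>a i\<bar>) = (\<Sum>j\<le>L+D. \<bar>exp (c L j) - 1\<bar>)"
      unfolding sum_shift_int[symmetric] a_c ..
    also have "\<dots> \<le> real (card {j. j \<le> L + D \<and> T L j \<noteq> 0}) / (1 - (1 + (1 - K) / 2) * K)"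
      by (rule sum_abs_le_card[where c="c L", OF \<alpha> K T\<delta> c])
    also have "\<dots> \<le> (real D + 1) / (1 - (1 + (1 - K) / 2) * K)"
      using card[of L] den by (intro divide_right_mono) auto
    finally show ?thesis .
  qed
  note a = summable_on_int_if_bounded_sums[of D a, OF a0 this]
  show "a summable_on UNIV" by (rule a(1))
  have U_sum: "(\<Sum>j\<le>L+D. shift_seq (- int L) s j * real (U (- int L + int j) j \<omega>))
      = (\<Sum>n\<le>D. s n * real (U (int n) (L + n) \<omega>))" for s L \<omega>
  proof -
    have "(\<Sum>j\<le>L+D. shift_seq (- int L) s j * real (U (- int L + int j) j \<omega>))
        = (\<Sum>j\<in>{L..L+D}. shift_seq (- int L) s j * real (U (- int L + int j) j \<omega>))"
      by (rule sum.mono_neutral_right) (auto simp: shift_seq_def)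
    also have "\<dots> = (\<Sum>n\<le>D. s n * real (U (int n) (L + n) \<omega>))"
      by (rule sum.reindex_bij_witness[of _ "\<lambda>n. L + n" "\<lambda>j. j - L"]) (auto simp: shift_seq_def nat_diff_distrib)
    finally show ?thesis .
  qed
  define u where "u L \<omega> = ennreal (exp (\<Sum>n\<le>D. t n * real (U (int n) (L + n) \<omega>)))" for L \<omega>
  \<comment> \<open>These converge to the dominating function \<open>v'\<close>; the positive parts
    of \<open>t\<close> still respect the radius, so the uniform bound applies to them.\<close>
  define v where "v L \<omega> = ennreal (exp (\<Sum>n\<le>D. max 0 (t n) * real (U (int n) (L + n) \<omega>)))" for L \<omega>
  define u' where "u' \<omega> = ennreal (exp (\<Sum>n\<le>D. t n * real (Y (int n) \<omega>)))" for \<omega>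
  define v' where "v' \<omega> = ennreal (exp (\<Sum>n\<le>D. max 0 (t n) * real (Y (int n) \<omega>)))" for \<omega>
  have meas: "(\<lambda>\<omega>. ennreal (exp (\<Sum>n\<le>D. s n * real (Z n \<omega>)))) \<in> borel_measurable M"
    if "\<And>n. Z n \<in> M \<rightarrow>\<^sub>M count_space UNIV" for s Z
  proof -
    have "(\<lambda>\<omega>. \<Sum>n\<le>D. s n * real (Z n \<omega>)) \<in> borel_measurable M"
      by (intro borel_measurable_sum borel_measurable_times borel_measurable_const
          borel_measurable_real_nat that)
    then show ?thesis by measurable
  qed
  have u_meas: "u L \<in> borel_measurable M" for L
    unfolding u_def[abs_def] by (rule meas[OF U_measurable])
  have v_meas: "v L \<in> borel_measurable M" for L
    unfolding v_def[abs_def] by (rule meas[OF U_measurable])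
  have u'_meas: "u' \<in> borel_measurable M"
    unfolding u'_def[abs_def] by (rule meas[OF Y_measurable])
  have v'_meas: "v' \<in> borel_measurable M"
    unfolding v'_def[abs_def] by (rule meas[OF Y_measurable])
  have int_u: "(\<integral>\<^sup>+\<omega>. u L \<omega> \<partial>M) = ennreal (exp (\<alpha> 0 * (\<Sum>i\<in>{- int L..int D}. a i)))" for L
    unfolding sum_shift_int[symmetric] a_c u_def U_sum[symmetric] T_def[symmetric]
    by (rule nn_integral_inar_trunc[where c="c L", OF \<alpha> c])
  have int_le: "(\<integral>\<^sup>+\<omega>. ennreal (exp (\<Sum>n\<le>D. s n * real (U (int n) (L + n) \<omega>))) \<partial>M)
      \<le> ennreal (exp (\<alpha> 0 * (real D + 1)))"
    if "\<And>n. s n \<le> ((1 - K) / 2)\<^sup>2" for s L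
  proof -
    let ?S = "shift_seq (- int L) s"
    have "?S n \<le> ((1 - K) / 2)\<^sup>2" for n using that by (simp add: shift_seq_def)
    from nn_integral_inar_trunc_le[where t="?S" and s="- int L" and m="L + D", OF \<alpha> K this]
    have "(\<integral>\<^sup>+\<omega>. ennreal (exp (\<Sum>n\<le>D. s n * real (U (int n) (L + n) \<omega>))) \<partial>M)
      \<le> ennreal (exp (\<alpha> 0 * real (card {j. j \<le> L + D \<and> ?S j \<noteq> 0})))"
      unfolding U_sum .
    also have "\<dots> \<le> ennreal (exp (\<alpha> 0 * (real D + 1)))"
    proof -
      have "{j. j \<le> L + D \<and> ?S j \<noteq> 0} \<subseteq> {L..L+D}"
        by (auto simp: shift_seq_def split: if_splits)
      from card_mono[OF _ this] have "card {j. j \<le> L + D \<and> ?S j \<noteq> 0} \<le> Suc D" by simp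
      then have "\<alpha> 0 * real (card {j. j \<le> L + D \<and> ?S j \<noteq> 0}) \<le> \<alpha> 0 * (real D + 1)"
        by (intro mult_left_mono \<alpha>) linarith
      then show ?thesis by (intro ennreal_leI) simp
    qed
    finally show ?thesis .
  qed
  have int_v: "(\<integral>\<^sup>+\<omega>. v L \<omega> \<partial>M) \<le> ennreal (exp (\<alpha> 0 * (real D + 1)))" for L
    unfolding v_def by (rule int_le) (use t in simp)
  have lims: "AE \<omega> in M. (\<lambda>L. u L \<omega>) \<longlonglongrightarrow> u' \<omega> \<and> (\<lambda>L. v L \<omega>) \<longlonglongrightarrow> v' \<omega> \<and> (\<forall>L. u L \<omega> \<le> v' \<omega>)"
    using AE_bdd_above_inar_trunc[OF \<alpha> K]
  proof eventually_elim
    case (elim \<omega>)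
    have "eventually (\<lambda>L. U (int n) (L + n) \<omega> = Y (int n) \<omega>) sequentially" for n
      using sequentially_offset[OF eventually_eq_inar_limit[OF spec[OF elim]], of "int n" n] .
    then have "eventually (\<lambda>L. \<forall>n\<in>{..D}. U (int n) (L + n) \<omega> = Y (int n) \<omega>) sequentially"
      by (intro eventually_ball_finite) auto
    then have "eventually (\<lambda>L. u L \<omega> = u' \<omega>) sequentially" "eventually (\<lambda>L. v L \<omega> = v' \<omega>) sequentially"
      by (auto simp: u_def u'_def v_def v'_def elim: eventually_mono)
    moreover have "u L \<omega> \<le> v' \<omega>" for L
    proof -
      have "t n * real (U (int n) (L + n) \<omega>) \<le> max 0 (t n) * real (Y (int n) \<omega>)" for n
        using inar_trunc_le_limit[OF spec[OF elim], of "int n" "L + n"]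
        by (intro mult_mono) auto
      then show ?thesis
        unfolding u_def v'_def by (intro ennreal_leI) (simp add: sum_mono)
    qed
    ultimately show ?case by (auto intro: tendsto_eventually)
  qed
  \<comment> \<open>Fatou's lemma carries the uniform bound over to \<open>v'\<close>, which makes
    it integrable.\<close>
  have "(\<integral>\<^sup>+\<omega>. v' \<omega> \<partial>M) = (\<integral>\<^sup>+\<omega>. liminf (\<lambda>L. v L \<omega>) \<partial>M)"
    by (rule nn_integral_cong_AE) (use lims in \<open>eventually_elim, auto intro: lim_imp_Liminf[symmetric]\<close>)
  also have "\<dots> \<le> liminf (\<lambda>L. \<integral>\<^sup>+\<omega>. v L \<omega> \<partial>M)"
    by (rule nn_integral_liminf[OF v_meas])
  also have "\<dots> \<le> ennreal (exp (\<alpha> 0 * (real D + 1)))"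
    by (rule Liminf_le) (simp_all add: int_v)
  finally have "(\<integral>\<^sup>+\<omega>. v' \<omega> \<partial>M) < \<infinity>"
    by (rule order_le_less_trans) simp
  then have "(\<lambda>L. \<integral>\<^sup>+\<omega>. u L \<omega> \<partial>M) \<longlonglongrightarrow> (\<integral>\<^sup>+\<omega>. u' \<omega> \<partial>M)"
    using lims by (intro nn_integral_dominated_convergence[OF u_meas u'_meas v'_meas]) auto
  moreover have mgf_eq: "joint_mgf M Y t = (\<integral>\<^sup>+\<omega>. u' \<omega> \<partial>M)"
  proof -
    have "(\<Sum>n. t n * real (Y (int n) \<omega>)) = (\<Sum>n\<le>D. t n * real (Y (int n) \<omega>))" for \<omega>
      by (rule suminf_finite) (auto simp: D)
    then show ?thesis by (simp add: joint_mgf_def u'_def)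
  qed
  ultimately have lim: "(\<lambda>L. \<integral>\<^sup>+\<omega>. u L \<omega> \<partial>M) \<longlonglongrightarrow> joint_mgf M Y t" by simp
  have "(\<lambda>L. \<integral>\<^sup>+\<omega>. u L \<omega> \<partial>M) \<longlonglongrightarrow> ennreal (exp (\<alpha> 0 * (\<Sum>\<^sub>\<infinity>i. a i)))"
    unfolding int_u by (intro tendsto_ennrealI tendsto_exp tendsto_mult tendsto_const a(2))
  with lim show "joint_mgf M Y t = ennreal (exp (\<alpha> 0 * (\<Sum>\<^sub>\<infinity>i. a i)))"
    by (rule LIMSEQ_unique)
  show "joint_mgf M Y t \<le> ennreal (exp (\<alpha> 0 * (real D + 1)))"
    by (rule LIMSEQ_le_const2[OF lim]) (auto simp: u_def intro!: int_le t)
qed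

end

theorem theorem2:
  fixes M :: "'a measure" and N :: "'b measure"
    and \<alpha> :: "nat \<Rightarrow> real" and K :: real
    and \<epsilon> :: "int \<Rightarrow> 'a \<Rightarrow> nat"
    and \<xi> :: "int \<Rightarrow> nat \<Rightarrow> nat \<Rightarrow> 'a \<Rightarrow> nat"
    and X :: "int \<Rightarrow> 'a \<Rightarrow> nat"
    and \<zeta> :: "int \<Rightarrow> nat \<Rightarrow> nat \<Rightarrow> nat \<Rightarrow> 'b \<Rightarrow> nat"
  assumes "\<And>k. \<alpha> k \<ge> 0"
    and "(\<lambda>k. \<alpha> (Suc k)) sums K" and "K < 1"
    and "inar M \<alpha> \<epsilon> \<xi> X"
    and "family_noise N \<alpha> \<zeta>"
  shows "\<exists>\<delta>>0.
    (\<forall>t\<in>c00 {..\<delta>}.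
       (K > 0 \<longrightarrow> joint_mgf M X t
          \<le> ennreal (exp (real (the_enat (seq_supp t) + 1) * \<alpha> 0 * ((1 + K) / (2 * K))))) \<and>
       joint_mgf M X t < \<infinity>) \<and>
    (\<forall>s\<in>c00 {..\<delta>}. joint_mgf N (family \<zeta>) s < \<infinity>) \<and>
    (let M\<^sub>F = (\<lambda>s. enn2real (joint_mgf N (family \<zeta>) s)) in
       (\<forall>t\<in>c00 {..\<delta>}.
          (\<lambda>i::int. M\<^sub>F (shift_seq i t) - 1) summable_on UNIV \<and>
          joint_mgf M X t = ennreal (exp (\<alpha> 0 * (\<Sum>\<^sub>\<infinity>i::int. (M\<^sub>F (shift_seq i t) - 1))))) \<and>
       solves_family_equation \<alpha> \<delta> M\<^sub>F \<and>
       (\<forall>\<phi>. \<phi> (\<lambda>_. 0) = 1 \<and> solves_family_equation \<alpha> \<delta> \<phi> \<longrightarrow>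
          (\<forall>s\<in>c00 {..\<delta>}. \<phi> s = M\<^sub>F s)))"
proof -
  note \<alpha> = assms(1) and K = assms(2,3)
  interpret inar M \<alpha> \<epsilon> \<xi> X by fact
  interpret F: family_noise N \<alpha> \<zeta> by fact
  define \<delta> where "\<delta> = ((1 - K) / 2)\<^sup>2"
  have "\<delta> > 0" using K(2) by (simp add: \<delta>_def)
  have mF: "(\<lambda>s. enn2real (joint_mgf N (family \<zeta>) s)) = F.mgf"
    by (rule ext) (simp add: F.mgf_def)
  \<comment> \<open>\<open>Y\<close> solves the recursion with the same noise as \<open>X\<close>,
    so the two agree almost surely.\<close>
  have X_Y: "joint_mgf M X t = joint_mgf M Y t" for t
    unfolding joint_mgf_def
    by (rule nn_integral_cong_AE)
      (use unique_solution[OF inar_solution_inar_limit[OF \<alpha> K]] in \<open>eventually_elim, simp\<close>)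
  have X_mgf: "(\<lambda>i. F.mgf (shift_seq i t) - 1) summable_on UNIV"
    "joint_mgf M X t = ennreal (exp (\<alpha> 0 * (\<Sum>\<^sub>\<infinity>i. F.mgf (shift_seq i t) - 1)))"
    "joint_mgf M X t \<le> ennreal (exp (\<alpha> 0 * (real (the_enat (seq_supp t)) + 1)))"
    if t: "t \<in> c00 {..\<delta>}" for t
  proof -
    have "t n \<le> ((1 - K) / 2)\<^sup>2" for n using t by (auto simp: c00_def \<delta>_def)
    note J = joint_mgf_inar_limit[OF \<alpha> K this c00_eq_0[OF t] F.mgf_eq[OF \<alpha>]]
    show "(\<lambda>i. F.mgf (shift_seq i t) - 1) summable_on UNIV" by (rule J(1))
    show "joint_mgf M X t = ennreal (exp (\<alpha> 0 * (\<Sum>\<^sub>\<infinity>i. F.mgf (shift_seq i t) - 1)))"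
      unfolding X_Y by (rule J(2))
    show "joint_mgf M X t \<le> ennreal (exp (\<alpha> 0 * (real (the_enat (seq_supp t)) + 1)))"
      unfolding X_Y by (rule J(3))
  qed
  have bound: "joint_mgf M X t
      \<le> ennreal (exp (real (the_enat (seq_supp t) + 1) * \<alpha> 0 * ((1 + K) / (2 * K))))"
    if t: "t \<in> c00 {..\<delta>}" and "K > 0" for t
  proof -
    \<comment> \<open>The exponent obtained so far is \<open>\<alpha> 0\<close> times the support
      plus 1; the stated factor is at least 1 because \<open>K < 1\<close>.\<close>
    have "1 \<le> (1 + K) / (2 * K)" using \<open>K > 0\<close> K(2) by simp
    then have "\<alpha> 0 * (real (the_enat (seq_supp t)) + 1)
        \<le> real (the_enat (seq_supp t) + 1) * \<alpha> 0 * ((1 + K) / (2 * K))"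
      using mult_left_mono[of 1 "(1 + K) / (2 * K)" "\<alpha> 0 * (real (the_enat (seq_supp t)) + 1)"] \<alpha>[of 0]
      by (simp add: ac_simps)
    then show ?thesis
      by (intro order_trans[OF X_mgf(3)[OF t]] ennreal_leI) simp
  qed
  have F_fin: "joint_mgf N (family \<zeta>) s < \<infinity>" if "s \<in> c00 {..\<delta>}" for s
    by (subst F.joint_mgf_family_cgf[OF \<alpha> c00_eq_0[OF that]]) simp_all
  show ?thesis
    unfolding mF Let_def
  proof (intro exI[of _ \<delta>] conjI ballI impI allI \<open>\<delta> > 0\<close> F_fin bound F.mgf_solves[OF \<alpha>] X_mgf)
    show "joint_mgf M X t < \<infinity>" if "t \<in> c00 {..\<delta>}" for t
      unfolding X_mgf(2)[OF that] by simp
    show "\<phi> s = F.mgf s"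
      if "\<phi> (\<lambda>_. 0) = 1 \<and> solves_family_equation \<alpha> \<delta> \<phi>" "s \<in> c00 {..\<delta>}" for \<phi> s
      by (rule family_equation_unique[OF _ F.mgf_solves[OF \<alpha>] _ that(2)])
        (use that(1) F.mgf_zero[OF \<alpha>] in auto)
  qed
qed

end
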